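(* Let $u$ be an inner function such that $\mathcal K_u^2=H^2\ominus uH^2$ is a proper non-zero subspace of $H^2$, and let $\varphi\in L^\infty$. Then the pair $(A_\varphi,A_z)$ of truncated Toeplitz operators on $\mathcal K_u^2$ is in the Agler-Young class if and only if $\varphi=\bar c+cz+g$ for some $c\in\mathbb C$ and some $g\in uH^2+\overline{uH^2}$. In this case, $A_\varphi$ and $A_z$ commute.
   Context: $H^2$ is the scalar Hardy space of the unit disc, regarded as a subspace of $L^2$ of the unit circle; $L^\infty$ is on the unit circle. $P_u$ is the orthogonal projection onto $\mathcal K_u^2$. The truncated Toeplitz operator with symbol $\varphi$ is $A_\varphi=P_uM_\varphi|_{\mathcal K_u^2}$, where $M_\varphi$ is multiplication by $\varphi$ (and $P_u$ is taken from $L^2$); $A_z$ is the one with symbol $z$. For a contraction $T$, $D_T=(I-T^*T)^{1/2}$, $\mathcal D_T=\overline{\mathrm{Ran}}\,D_T$. A pair $(S_1,S_2)$ of bounded operators is in the Agler-Young class $AY_2$ if $S_2$ is a contraction and there is $X\in\mathcal B(\mathcal D_{S_2})$ with $S_1-S_1^*S_2=D_{S_2}XD_{S_2}$. *)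

theory Defs
  imports "HOL-Analysis.Analysis"
begin

text \<open>
  The norm, the topology and the real inner product are those of \<^class>\<open>real_inner\<close>; the complex
  inner product is linear in its first argument, and its real part is the real inner product.
\<close>

class complex_hilbert = real_inner + complete_space +
  fixes scaleC :: "complex \<Rightarrow> 'a \<Rightarrow> 'a" (infixr "*\<^sub>C" 75)
    and cinner :: "'a \<Rightarrow> 'a \<Rightarrow> complex"
  assumes scaleC_add_right: "a *\<^sub>C (x + y) = a *\<^sub>C x + a *\<^sub>C y"
    and scaleC_add_left: "(a + b) *\<^sub>C x = a *\<^sub>C x + b *\<^sub>C x"
    and scaleC_scaleC: "a *\<^sub>C (b *\<^sub>C x) = (a * b) *\<^sub>C x"
    and scaleC_of_real: "complex_of_real r *\<^sub>C x = r *\<^sub>R x"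
    and cinner_commute: "cinner x y = cnj (cinner y x)"
    and cinner_add_left: "cinner (x + y) z = cinner x z + cinner y z"
    and cinner_scaleC_left: "cinner (a *\<^sub>C x) y = a * cinner x y"
    and Re_cinner: "Re (cinner x y) = inner x y"

text \<open>
  In the following operator-theoretic notions \<open>K\<close> is a closed complex subspace of the ambient Hilbert space, itself regarded as a
  Hilbert space. Operators on \<open>K\<close> are extensional functions (with the value \<^const>\<open>undefined\<close>
  outside \<open>K\<close>), so that two operators on \<open>K\<close> are equal as functions iff they agree on \<open>K\<close>.
\<close>

definition bounded_ops :: "'a::complex_hilbert set \<Rightarrow> ('a \<Rightarrow> 'a) set"
  where "bounded_ops K = {T \<in> K \<rightarrow>\<^sub>E K.
    (\<forall>x\<in>K. \<forall>y\<in>K. T (x + y) = T x + T y) \<and>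
    (\<forall>a. \<forall>x\<in>K. T (a *\<^sub>C x) = a *\<^sub>C T x) \<and>
    (\<exists>C. \<forall>x\<in>K. norm (T x) \<le> C * norm x)}"

definition contraction_op :: "'a::complex_hilbert set \<Rightarrow> ('a \<Rightarrow> 'a) \<Rightarrow> bool"
  where "contraction_op K T \<longleftrightarrow> T \<in> bounded_ops K \<and> (\<forall>x\<in>K. norm (T x) \<le> norm x)"

definition adjoint_op :: "'a::complex_hilbert set \<Rightarrow> ('a \<Rightarrow> 'a) \<Rightarrow> 'a \<Rightarrow> 'a"
  where "adjoint_op K T = (THE S. S \<in> bounded_ops K \<and> (\<forall>x\<in>K. \<forall>y\<in>K. cinner (T x) y = cinner x (S y)))"

text \<open>On a complex Hilbert space \<open>cinner (T x) x \<in> \<real>\<close> for all \<open>x\<close> already makes \<open>T\<close> selfadjoint.\<close>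

definition positive_op :: "'a::complex_hilbert set \<Rightarrow> ('a \<Rightarrow> 'a) \<Rightarrow> bool"
  where "positive_op K T \<longleftrightarrow> T \<in> bounded_ops K \<and>
    (\<forall>x\<in>K. cinner (T x) x \<in> \<real> \<and> 0 \<le> Re (cinner (T x) x))"

definition sqrt_op :: "'a::complex_hilbert set \<Rightarrow> ('a \<Rightarrow> 'a) \<Rightarrow> 'a \<Rightarrow> 'a"
  where "sqrt_op K P = (THE R. positive_op K R \<and> (\<forall>x\<in>K. R (R x) = P x))"

definition defect_op :: "'a::complex_hilbert set \<Rightarrow> ('a \<Rightarrow> 'a) \<Rightarrow> 'a \<Rightarrow> 'a"
  where "defect_op K T = sqrt_op K (\<lambda>x\<in>K. x - adjoint_op K T (T x))"

definition defect_space :: "'a::complex_hilbert set \<Rightarrow> ('a \<Rightarrow> 'a) \<Rightarrow> 'a set"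
  where "defect_space K T = closure (defect_op K T ` K)"

definition agler_young :: "'a::complex_hilbert set \<Rightarrow> ('a \<Rightarrow> 'a) \<Rightarrow> ('a \<Rightarrow> 'a) \<Rightarrow> bool"
  where "agler_young K S1 S2 \<longleftrightarrow> S1 \<in> bounded_ops K \<and> contraction_op K S2 \<and>
    (\<exists>X\<in>bounded_ops (defect_space K S2). \<forall>x\<in>K.
       S1 x - adjoint_op K S1 (S2 x) = defect_op K S2 (X (defect_op K S2 x)))"

definition orth_proj :: "'a::complex_hilbert set \<Rightarrow> 'a \<Rightarrow> 'a"
  where "orth_proj K x = (THE y. y \<in> K \<and> (\<forall>k\<in>K. cinner (x - y) k = 0))"

text \<open>
  Normalised arc length, as a measure on the whole plane; almost every point lies on the unit
  circle, so the coordinate function of the circle is simply \<open>\<lambda>z. z\<close>.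
\<close>

definition circle :: "complex measure"
  where "circle = distr (uniform_measure lborel {0..2*pi}) borel cis"

lemma sets_circle [simp, measurable_cong]: "sets circle = sets borel"
  by (simp add: circle_def)

lemma space_circle [simp]: "space circle = UNIV"
  by (simp add: circle_def)

lemma measurable_cis [measurable]: "cis \<in> borel_measurable borel"
  by (intro borel_measurable_continuous_onI continuous_intros)

lemma measurable_cnj [measurable]: "cnj \<in> borel_measurable borel"
  by (intro borel_measurable_continuous_onI continuous_intros)

lemma prob_space_uniform: "emeasure (uniform_measure lborel {0..2*pi}) UNIV = 1"
proof -
  have "emeasure (uniform_measure lborel {0..2*pi}) UNIV
      = emeasure lborel {0..2*pi} / emeasure lborel {0..2*pi}"
    by (subst emeasure_uniform_measure) auto
  also have "\<dots> = 1"
    by (simp add: ennreal_divide_self flip: ennreal_numeral ennreal_mult)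
  finally show ?thesis .
qed

lemma emeasure_circle [simp]: "emeasure circle UNIV = 1"
  unfolding circle_def using prob_space_uniform by (simp add: emeasure_distr)

lemma finite_measure_circle: "finite_measure circle"
  by (rule finite_measureI) simp

lemma AE_circle_norm: "AE z in circle. norm z = 1"
proof -
  have "{z. norm z = (1::real)} \<in> sets (borel :: complex measure)" by measurable
  then show ?thesis
    unfolding circle_def by (subst AE_distr_iff) auto
qed

definition square_integrable :: "(complex \<Rightarrow> complex) \<Rightarrow> bool"
  where "square_integrable f \<longleftrightarrow>
    f \<in> borel_measurable circle \<and> integrable circle (\<lambda>z. (norm (f z))\<^sup>2)"

text \<open>Every class of the Lebesgue space \<open>L\<^sup>\<infinity>\<close> of the circle has a Borel representative.\<close>

definition Linf :: "(complex \<Rightarrow> complex) set"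
  where "Linf = {\<phi> \<in> borel_measurable circle. \<exists>C. AE z in circle. norm (\<phi> z) \<le> C}"

lemma square_integrable_measurable:
  "square_integrable f \<Longrightarrow> f \<in> borel_measurable circle"
  by (simp add: square_integrable_def)

lemma square_integrable_zero: "square_integrable (\<lambda>_. 0)"
  by (simp add: square_integrable_def)

lemma square_integrable_add:
  assumes "square_integrable f" "square_integrable g"
  shows "square_integrable (\<lambda>z. f z + g z)"
proof -
  have [measurable]: "f \<in> borel_measurable borel" "g \<in> borel_measurable borel"
    using assms by (auto simp: square_integrable_def cong: measurable_cong_sets)
  have "norm ((norm (f z + g z))\<^sup>2) \<le> norm (2 * (norm (f z))\<^sup>2 + 2 * (norm (g z))\<^sup>2)" for z
  proof -
    have "(norm (f z + g z))\<^sup>2 \<le> (norm (f z) + norm (g z))\<^sup>2"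
      by (simp add: norm_triangle_ineq power_mono)
    also have "\<dots> \<le> 2 * (norm (f z))\<^sup>2 + 2 * (norm (g z))\<^sup>2"
      using sum_squares_bound[of "norm (f z)" "norm (g z)"] by (simp add: power2_sum)
    finally show ?thesis by simp
  qed
  moreover have "integrable circle (\<lambda>z. 2 * (norm (f z))\<^sup>2 + 2 * (norm (g z))\<^sup>2)"
    using assms by (simp add: square_integrable_def)
  ultimately have "integrable circle (\<lambda>z. (norm (f z + g z))\<^sup>2)"
    by (intro Bochner_Integration.integrable_bound[where g = "\<lambda>z. (norm (f z + g z))\<^sup>2"]) auto
  then show ?thesis by (simp add: square_integrable_def)
qed

lemma square_integrable_mult_Linf:
  assumes "\<phi> \<in> Linf" "square_integrable f"
  shows "square_integrable (\<lambda>z. \<phi> z * f z)"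
proof -
  obtain C where C: "AE z in circle. norm (\<phi> z) \<le> C"
    using assms(1) by (auto simp: Linf_def)
  have [measurable]: "f \<in> borel_measurable borel" "\<phi> \<in> borel_measurable borel"
    using assms by (auto simp: square_integrable_def Linf_def cong: measurable_cong_sets)
  have "integrable circle (\<lambda>z. (norm (\<phi> z * f z))\<^sup>2)"
  proof (rule Bochner_Integration.integrable_bound)
    show "integrable circle (\<lambda>z. C\<^sup>2 * (norm (f z))\<^sup>2)"
      using assms(2) by (simp add: square_integrable_def)
    show "AE z in circle. norm ((norm (\<phi> z * f z))\<^sup>2) \<le> norm (C\<^sup>2 * (norm (f z))\<^sup>2)"
      using C by eventually_elim (auto simp: norm_mult power_mult_distrib intro!: mult_right_mono power_mono)
  qed simp
  then show ?thesis by (simp add: square_integrable_def)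
qed

lemma const_Linf: "(\<lambda>_. c) \<in> Linf"
  by (auto simp: Linf_def)

lemma square_integrable_scale: "square_integrable f \<Longrightarrow> square_integrable (\<lambda>z. c * f z)"
  using square_integrable_mult_Linf[OF const_Linf] .

lemma square_integrable_cnj: "square_integrable f \<Longrightarrow> square_integrable (\<lambda>z. cnj (f z))"
  by (auto simp: square_integrable_def intro: measurable_compose[OF _ measurable_cnj])

lemma integrable_mult_cnj:
  assumes "square_integrable f" "square_integrable g"
  shows "integrable circle (\<lambda>z. f z * cnj (g z))"
proof -
  have [measurable]: "f \<in> borel_measurable borel" "g \<in> borel_measurable borel"
    using assms by (auto simp: square_integrable_def cong: measurable_cong_sets)
  show ?thesis
  proof (rule Bochner_Integration.integrable_bound)
    show "integrable circle (\<lambda>z. (norm (f z))\<^sup>2 + (norm (g z))\<^sup>2)"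
      using assms by (simp add: square_integrable_def)
    have "norm (f z * cnj (g z)) \<le> norm ((norm (f z))\<^sup>2 + (norm (g z))\<^sup>2)" for z
    proof -
      have "2 * norm (f z) * norm (g z) \<le> (norm (f z))\<^sup>2 + (norm (g z))\<^sup>2"
        by (rule sum_squares_bound)
      moreover have "0 \<le> norm (f z) * norm (g z)" by simp
      ultimately have "norm (f z) * norm (g z) \<le> (norm (f z))\<^sup>2 + (norm (g z))\<^sup>2" by linarith
      then show ?thesis by (simp add: norm_mult)
    qed
    then show "AE z in circle. norm (f z * cnj (g z)) \<le> norm ((norm (f z))\<^sup>2 + (norm (g z))\<^sup>2)"
      by simp
  qed simp
qed

definition L2_rel :: "(complex \<Rightarrow> complex) \<Rightarrow> (complex \<Rightarrow> complex) \<Rightarrow> bool"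
  where "L2_rel f g \<longleftrightarrow> square_integrable f \<and> square_integrable g \<and> (AE z in circle. f z = g z)"

lemma part_equivp_L2_rel: "part_equivp L2_rel"
proof (rule part_equivpI)
  show "\<exists>f. L2_rel f f"
    using square_integrable_zero by (auto simp: L2_rel_def)
  show "symp L2_rel"
    by (auto simp: symp_def L2_rel_def elim: eventually_mono)
  show "transp L2_rel"
  proof (rule transpI)
    fix f g h
    assume "L2_rel f g" "L2_rel g h"
    then have "AE z in circle. f z = g z" "AE z in circle. g z = h z"
      by (simp_all add: L2_rel_def)
    then have "AE z in circle. f z = h z"
      by eventually_elim simp
    with \<open>L2_rel f g\<close> \<open>L2_rel g h\<close> show "L2_rel f h" by (simp add: L2_rel_def)
  qed
qed

quotient_type l2_circle = "complex \<Rightarrow> complex" / partial: L2_rel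
  by (rule part_equivp_L2_rel)

instantiation l2_circle :: real_vector
begin

lift_definition zero_l2_circle :: l2_circle is "\<lambda>_. 0"
  by (simp add: L2_rel_def square_integrable_zero)

lift_definition plus_l2_circle :: "l2_circle \<Rightarrow> l2_circle \<Rightarrow> l2_circle" is "\<lambda>f g z. f z + g z"
  unfolding L2_rel_def by (auto intro: square_integrable_add)

lift_definition uminus_l2_circle :: "l2_circle \<Rightarrow> l2_circle" is "\<lambda>f z. - f z"
  unfolding L2_rel_def using square_integrable_scale[of _ "-1"] by auto

lift_definition scaleR_l2_circle :: "real \<Rightarrow> l2_circle \<Rightarrow> l2_circle"
  is "\<lambda>r f z. complex_of_real r * f z"
  unfolding L2_rel_def by (auto intro: square_integrable_scale elim: eventually_mono)

definition "f - g = f + - g" for f g :: l2_circle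

instance
proof
  fix a b c :: l2_circle and r s :: real
  show "a + b + c = a + (b + c)"
    by transfer (simp add: L2_rel_def square_integrable_add algebra_simps)
  show "a + b = b + a"
    by transfer (simp add: L2_rel_def square_integrable_add algebra_simps)
  show "0 + a = a"
    by transfer (simp add: L2_rel_def)
  show "- a + a = 0"
    by transfer (simp add: L2_rel_def square_integrable_zero)
  show "a - b = a + - b" by (simp add: minus_l2_circle_def)
  show "r *\<^sub>R (a + b) = r *\<^sub>R a + r *\<^sub>R b"
    by transfer (simp add: L2_rel_def square_integrable_add square_integrable_scale distrib_left)
  show "(r + s) *\<^sub>R a = r *\<^sub>R a + s *\<^sub>R a"
    by transfer (simp add: L2_rel_def square_integrable_add square_integrable_scale
        distrib_right)
  show "r *\<^sub>R s *\<^sub>R a = (r * s) *\<^sub>R a"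
    by transfer (simp add: L2_rel_def square_integrable_scale flip: of_real_mult mult.assoc)
  show "1 *\<^sub>R a = a"
    by transfer (simp add: L2_rel_def)
qed

end

lemma L2_rel_rep: "L2_rel (rep_l2_circle f) (rep_l2_circle f)"
  by (metis Quotient_l2_circle Quotient_rep_reflp)

lemma square_integrable_rep: "square_integrable (rep_l2_circle f)"
  using L2_rel_rep by (simp add: L2_rel_def)

lemma abs_rep_l2_circle: "abs_l2_circle (rep_l2_circle f) = f"
  by (metis Quotient_l2_circle Quotient_abs_rep)

lemma rep_abs_l2_circle:
  "square_integrable f \<Longrightarrow> AE z in circle. rep_l2_circle (abs_l2_circle f) z = f z"
  using Quotient_rep_abs[OF Quotient_l2_circle, of f] by (simp add: L2_rel_def)

lemma square_integrable_diff:
  "square_integrable f \<Longrightarrow> square_integrable g \<Longrightarrow> square_integrable (\<lambda>z. f z - g z)"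
  using square_integrable_add[of f "\<lambda>z. - 1 * g z"] square_integrable_scale[of g "-1"] by simp

lemma diff_abs_l2_circle:
  assumes "square_integrable f" "square_integrable g"
  shows "abs_l2_circle f - abs_l2_circle g = abs_l2_circle (\<lambda>z. f z - g z)"
proof -
  have "square_integrable (\<lambda>z. - g z)"
    using square_integrable_scale[of g "-1"] assms by simp
  then show ?thesis
    using assms
    by (simp add: minus_l2_circle_def uminus_l2_circle.abs_eq plus_l2_circle.abs_eq L2_rel_def)
qed

lemma integral_mult_cnj_commute:
  "(\<integral>z. f z * cnj (g z) \<partial>circle) = cnj (\<integral>z. g z * cnj (f z) \<partial>circle)"
proof -
  have "(\<lambda>z. f z * cnj (g z)) = (\<lambda>z. cnj (g z * cnj (f z)))"
    by (simp add: mult.commute)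
  then show ?thesis by (simp only: Bochner_Integration.integral_cnj)
qed

lemma Re_integral_mult_cnj_commute:
  "Re (\<integral>z. f z * cnj (g z) \<partial>circle) = Re (\<integral>z. g z * cnj (f z) \<partial>circle)"
  by (subst integral_mult_cnj_commute) simp

lemma Re_integral_mult_cnj_self:
  "Re (\<integral>z. f z * cnj (f z) \<partial>circle) = (\<integral>z. (norm (f z))\<^sup>2 \<partial>circle)"
proof -
  have "(\<lambda>z. f z * cnj (f z)) = (\<lambda>z. complex_of_real ((norm (f z))\<^sup>2))"
    by (rule ext) (rule complex_norm_square[symmetric])
  then show ?thesis by (simp only: integral_complex_of_real Re_complex_of_real)
qed

lemma square_integrableI_nn:
  assumes [measurable]: "f \<in> borel_measurable borel"
    and "(\<integral>\<^sup>+z. ennreal ((norm (f z))\<^sup>2) \<partial>circle) \<le> ennreal e"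
  shows "square_integrable f" and "0 \<le> e \<Longrightarrow> (\<integral>z. (norm (f z))\<^sup>2 \<partial>circle) \<le> e"
proof -
  have i: "integrable circle (\<lambda>z. (norm (f z))\<^sup>2)"
    using assms(2) by (intro integrableI_bounded) (auto intro: le_less_trans)
  then show "square_integrable f" by (simp add: square_integrable_def)
  show "0 \<le> e \<Longrightarrow> (\<integral>z. (norm (f z))\<^sup>2 \<partial>circle) \<le> e"
    using assms(2) nn_integral_eq_integral[OF i] by simp
qed

lemma riesz_fischer_circle:
  fixes x :: "nat \<Rightarrow> complex \<Rightarrow> complex"
  assumes si: "\<And>n. square_integrable (x n)"
    and Cauchy: "\<And>e. 0 < e \<Longrightarrow> \<exists>N. \<forall>m\<ge>N. \<forall>n\<ge>N. (\<integral>z. (norm (x m z - x n z))\<^sup>2 \<partial>circle) \<le> e"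
  obtains g where "square_integrable g"
    and "\<forall>e>0. \<exists>N. \<forall>m\<ge>N. (\<integral>z. (norm (x m z - g z))\<^sup>2 \<partial>circle) \<le> e"
proof -
  have [measurable]: "x n \<in> borel_measurable borel" for n
    using si[of n] by (auto simp: square_integrable_def cong: measurable_cong_sets)
  have "\<exists>M. \<forall>k::nat. \<forall>m\<ge>M k. \<forall>n\<ge>M k. (\<integral>z. (norm (x m z - x n z))\<^sup>2 \<partial>circle) \<le> (1/4)^k"
    using Cauchy by (intro choice allI) simp
  then obtain M :: "nat \<Rightarrow> nat" where M:
    "\<And>k m n. M k \<le> m \<Longrightarrow> M k \<le> n \<Longrightarrow> (\<integral>z. (norm (x m z - x n z))\<^sup>2 \<partial>circle) \<le> (1/4)^k"
    by blast
  define s where "s n = (\<Sum>k\<le>n. M k)" for n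
  have Ms: "M k \<le> s n" if "k \<le> n" for k n
    using that by (auto simp: s_def intro: member_le_sum)
  define y where "y n = x (s n)" for n
  have [measurable]: "y n \<in> borel_measurable borel" for n
    by (simp add: y_def)
  have nn: "(\<integral>\<^sup>+z. ennreal ((norm (x m z - x n z))\<^sup>2) \<partial>circle) \<le> ennreal ((1/4)^k)"
    if "M k \<le> m" "M k \<le> n" for k m n
  proof -
    have "integrable circle (\<lambda>z. (norm (x m z - x n z))\<^sup>2)"
      using square_integrable_diff[OF si si] by (simp add: square_integrable_def)
    then show ?thesis
      using M[OF that] by (subst nn_integral_eq_integral) (auto intro: ennreal_leI)
  qed
  have step: "(\<integral>\<^sup>+z. ennreal (norm (y (Suc n) z - y n z)) \<partial>circle) \<le> ennreal (2 * (1/2)^n)" for n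
  proof -
    have bound: "t \<le> 2^n * t\<^sup>2 + (1/2)^n" for t :: real
    proof -
      have p: "2^n * (1/2::real)^n = 1" by (simp add: power_one_over)
      have "0 \<le> 2^n * (t - (1/2)^n)\<^sup>2" by simp
      also have "\<dots> = 2^n * t\<^sup>2 - 2 * t * (2^n * (1/2)^n) + (2^n * (1/2)^n) * (1/2)^n"
        by (simp only: power2_eq_square) algebra
      finally have "2 * t \<le> 2^n * t\<^sup>2 + (1/2)^n" by (simp add: p)
      moreover have "0 \<le> 2^n * t\<^sup>2 + (1/2::real)^n" by simp
      ultimately show ?thesis by linarith
    qed
    have "(\<integral>\<^sup>+z. ennreal (norm (y (Suc n) z - y n z)) \<partial>circle)
        \<le> (\<integral>\<^sup>+z. ennreal (2^n) * ennreal ((norm (y (Suc n) z - y n z))\<^sup>2) + ennreal ((1/2)^n) \<partial>circle)"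
      using bound by (intro nn_integral_mono)
        (auto simp flip: ennreal_mult' ennreal_plus intro!: ennreal_leI)
    also have "\<dots> = ennreal (2^n) * (\<integral>\<^sup>+z. ennreal ((norm (y (Suc n) z - y n z))\<^sup>2) \<partial>circle)
        + ennreal ((1/2)^n)"
      by (subst nn_integral_add) (auto simp: nn_integral_cmult)
    also have "\<dots> \<le> ennreal (2^n) * ennreal ((1/4)^n) + ennreal ((1/2)^n)"
      unfolding y_def by (intro add_right_mono mult_left_mono nn Ms) auto
    also have "\<dots> = ennreal (2^n * (1/4)^n + (1/2)^n)"
      by (simp flip: ennreal_mult' ennreal_plus)
    also have "2^n * (1/4)^n + (1/2)^n = 2 * (1/2::real)^n"
      by (simp flip: power_mult_distrib)
    finally show ?thesis .
  qed
  have "(\<integral>\<^sup>+z. (\<Sum>n. ennreal (norm (y (Suc n) z - y n z))) \<partial>circle)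
      = (\<Sum>n. \<integral>\<^sup>+z. ennreal (norm (y (Suc n) z - y n z)) \<partial>circle)"
    by (intro nn_integral_suminf) auto
  also have "\<dots> \<le> (\<Sum>n. ennreal (2 * (1/2)^n))"
    by (intro suminf_le step) auto
  also have "\<dots> = ennreal (\<Sum>n. 2 * (1/2)^n)"
    by (intro suminf_ennreal2) (auto intro: summable_geometric)
  also have "\<dots> < \<infinity>" by simp
  finally have "AE z in circle. (\<Sum>n. ennreal (norm (y (Suc n) z - y n z))) \<noteq> \<infinity>"
    by (intro nn_integral_noteq_infinite) auto
  then have conv: "AE z in circle. convergent (\<lambda>n. y n z)"
  proof eventually_elim
    case (elim z)
    then have "summable (\<lambda>n. norm (y (Suc n) z - y n z))"
      by (intro summable_suminf_not_top) auto
    then have "summable (\<lambda>n. y (Suc n) z - y n z)"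
      by (rule summable_norm_cancel)
    then have "convergent (\<lambda>n. \<Sum>i<n. y (Suc i) z - y i z)"
      by (rule summable_iff_convergent[THEN iffD1])
    moreover have "(\<Sum>i<n. y (Suc i) z - y i z) = y n z - y 0 z" for n
      by (rule sum_lessThan_telescope[of "\<lambda>i. y i z"])
    ultimately have "convergent (\<lambda>n. y n z - y 0 z)"
      by (simp only:)
    then show ?case
      using convergent_add_const_iff[of "- y 0 z" "\<lambda>n. y n z"] by simp
  qed
  define g where "g z = lim (\<lambda>n. y n z)" for z
  have [measurable]: "g \<in> borel_measurable borel"
    unfolding g_def by (intro borel_measurable_lim_metric) auto
  have main: "(\<integral>\<^sup>+z. ennreal ((norm (x m z - g z))\<^sup>2) \<partial>circle) \<le> ennreal ((1/4)^k)" if "M k \<le> m" for k m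
  proof -
    have "(\<integral>\<^sup>+z. ennreal ((norm (x m z - g z))\<^sup>2) \<partial>circle)
        = (\<integral>\<^sup>+z. liminf (\<lambda>n. ennreal ((norm (x m z - y n z))\<^sup>2)) \<partial>circle)"
    proof (intro nn_integral_cong_AE)
      show "AE z in circle. ennreal ((norm (x m z - g z))\<^sup>2)
          = liminf (\<lambda>n. ennreal ((norm (x m z - y n z))\<^sup>2))"
        using conv
      proof eventually_elim
        case (elim z)
        then have "(\<lambda>n. y n z) \<longlonglongrightarrow> g z" by (simp add: g_def convergent_LIMSEQ_iff)
        then have "(\<lambda>n. ennreal ((norm (x m z - y n z))\<^sup>2)) \<longlonglongrightarrow> ennreal ((norm (x m z - g z))\<^sup>2)"
          by (intro tendsto_intros tendsto_ennrealI)
        from lim_imp_Liminf[OF sequentially_bot this] show ?case by (rule sym)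
      qed
    qed
    also have "\<dots> \<le> liminf (\<lambda>n. \<integral>\<^sup>+z. ennreal ((norm (x m z - y n z))\<^sup>2) \<partial>circle)"
      by (intro nn_integral_liminf) auto
    also have "\<dots> \<le> ennreal ((1/4)^k)"
    proof (rule Liminf_le)
      show "\<forall>\<^sub>F n in sequentially. (\<integral>\<^sup>+z. ennreal ((norm (x m z - y n z))\<^sup>2) \<partial>circle) \<le> ennreal ((1/4)^k)"
        using eventually_ge_at_top[of k]
        unfolding y_def by eventually_elim (intro nn that Ms)
    qed simp
    finally show ?thesis .
  qed
  have d: "square_integrable (\<lambda>z. x m z - g z)" "(\<integral>z. (norm (x m z - g z))\<^sup>2 \<partial>circle) \<le> (1/4)^k"
    if "M k \<le> m" for k m
    using square_integrableI_nn[OF _ main[OF that]] by auto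
  have "square_integrable (\<lambda>z. x (M 0) z - (x (M 0) z - g z))"
    by (rule square_integrable_diff[OF si d(1)[OF order_refl]])
  then have "square_integrable g" by simp
  moreover have "\<exists>N. \<forall>m\<ge>N. (\<integral>z. (norm (x m z - g z))\<^sup>2 \<partial>circle) \<le> e" if e: "0 < e" for e :: real
  proof -
    obtain k where "(1/4)^k < e"
      using real_arch_pow_inv[OF e, of "1/4"] by auto
    then show ?thesis using d(2) by (meson less_imp_le order_trans)
  qed
  ultimately show ?thesis using that by blast
qed

lemma integral_mult_cnj_cong:
  assumes "L2_rel f f'" "L2_rel g g'"
  shows "(\<integral>z. f z * cnj (g z) \<partial>circle) = (\<integral>z. f' z * cnj (g' z) \<partial>circle)"
proof -
  from assms have m: "integrable circle (\<lambda>z. f z * cnj (g z))" "integrable circle (\<lambda>z. f' z * cnj (g' z))"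
    and "AE z in circle. f z = f' z" "AE z in circle. g z = g' z"
    by (auto simp: L2_rel_def integrable_mult_cnj)
  then have "AE z in circle. f z * cnj (g z) = f' z * cnj (g' z)"
    by (auto elim: eventually_elim2)
  with m show ?thesis
    by (intro integral_cong_AE) (auto simp: integrable_iff_bounded)
qed

instantiation l2_circle :: real_inner
begin

lift_definition inner_l2_circle :: "l2_circle \<Rightarrow> l2_circle \<Rightarrow> real"
  is "\<lambda>f g. Re (\<integral>z. f z * cnj (g z) \<partial>circle)"
  by (simp only: integral_mult_cnj_cong)

definition "norm f = sqrt (inner f f)" for f :: l2_circle

definition "sgn f = f /\<^sub>R norm f" for f :: l2_circle

definition "dist f g = norm (f - g)" for f g :: l2_circle

definition "(uniformity :: (l2_circle \<times> l2_circle) filter) = (INF e\<in>{0<..}. principal {(f, g). dist f g < e})"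

definition "open U = (\<forall>f\<in>U. \<forall>\<^sub>F (f', g) in uniformity. f' = f \<longrightarrow> g \<in> U)" for U :: "l2_circle set"

instance
proof
  fix f g h :: l2_circle and r :: real
  show "inner f g = inner g f"
    by transfer (subst Re_integral_mult_cnj_commute, rule refl)
  show "inner (f + g) h = inner f h + inner g h"
    by transfer (simp add: L2_rel_def distrib_right integrable_mult_cnj)
  show "inner (r *\<^sub>R f) g = r * inner f g"
    by transfer (simp add: mult.assoc)
  show "0 \<le> inner f f"
    by transfer (simp only: Re_integral_mult_cnj_self, simp)
  show "(inner f f = 0) = (f = 0)"
  proof transfer
    fix f assume "L2_rel f f"
    then show "(Re (\<integral>z. f z * cnj (f z) \<partial>circle) = 0) = L2_rel f (\<lambda>_. 0)"
      by (simp only: Re_integral_mult_cnj_self)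
        (simp add: L2_rel_def square_integrable_zero square_integrable_def
          integral_nonneg_eq_0_iff_AE)
  qed
  show "norm f = sqrt (inner f f)" by (simp add: norm_l2_circle_def)
  show "sgn f = f /\<^sub>R norm f" by (simp add: sgn_l2_circle_def)
  show "dist f g = norm (f - g)" by (simp add: dist_l2_circle_def)
  show "(uniformity :: (l2_circle \<times> l2_circle) filter) = (INF e\<in>{0<..}. principal {(f, g). dist f g < e})"
    by (simp add: uniformity_l2_circle_def)
  show "open U = (\<forall>f\<in>U. \<forall>\<^sub>F (f', g) in uniformity. f' = f \<longrightarrow> g \<in> U)" for U :: "l2_circle set"
    by (simp add: open_l2_circle_def)
qed

end

lemma dist_l2_circle_power2:
  "(dist f g)\<^sup>2 = (\<integral>z. (norm (rep_l2_circle f z - rep_l2_circle g z))\<^sup>2 \<partial>circle)" for f g :: l2_circle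
proof -
  have si: "square_integrable (\<lambda>z. rep_l2_circle f z - rep_l2_circle g z)"
    by (intro square_integrable_diff square_integrable_rep)
  have "f - g = abs_l2_circle (\<lambda>z. rep_l2_circle f z - rep_l2_circle g z)"
    using diff_abs_l2_circle[OF square_integrable_rep square_integrable_rep, of f g]
    by (simp add: abs_rep_l2_circle)
  then have "inner (f - g) (f - g) = (\<integral>z. (norm (rep_l2_circle f z - rep_l2_circle g z))\<^sup>2 \<partial>circle)"
    using si by (simp add: inner_l2_circle.abs_eq L2_rel_def
        Re_integral_mult_cnj_self del: complex_mult_cnj complex_cnj_diff)
  then show ?thesis by (simp add: dist_l2_circle_def norm_l2_circle_def)
qed

instance l2_circle :: complete_space
proof
  fix X :: "nat \<Rightarrow> l2_circle"
  assume C: "Cauchy X"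
  have ex: "\<exists>N. \<forall>m\<ge>N. \<forall>n\<ge>N. (\<integral>z. (norm (rep_l2_circle (X m) z - rep_l2_circle (X n) z))\<^sup>2 \<partial>circle) \<le> e"
    if "0 < e" for e
  proof -
    obtain N where N: "\<forall>m\<ge>N. \<forall>n\<ge>N. dist (X m) (X n) < sqrt e"
      using metric_CauchyD[OF C real_sqrt_gt_zero[OF \<open>0 < e\<close>]] ..
    have "(dist (X m) (X n))\<^sup>2 \<le> e" if "m \<ge> N" "n \<ge> N" for m n
    proof -
      have "dist (X m) (X n) \<le> sqrt e" using N that by (simp add: less_imp_le)
      then have "(dist (X m) (X n))\<^sup>2 \<le> (sqrt e)\<^sup>2" by (simp only: power_mono zero_le_dist)
      then show ?thesis using \<open>0 < e\<close> by simp
    qed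
    then show ?thesis unfolding dist_l2_circle_power2 by blast
  qed
  obtain g where g: "square_integrable g"
    "\<forall>e>0. \<exists>N. \<forall>m\<ge>N. (\<integral>z. (norm (rep_l2_circle (X m) z - g z))\<^sup>2 \<partial>circle) \<le> e"
    by (rule riesz_fischer_circle[of "\<lambda>n. rep_l2_circle (X n)", OF square_integrable_rep ex])
  have [measurable]: "g \<in> borel_measurable circle" "rep_l2_circle f \<in> borel_measurable circle" for f
    using g(1) square_integrable_rep by (blast dest: square_integrable_measurable)+
  have dist_eq: "(dist (X m) (abs_l2_circle g))\<^sup>2 = (\<integral>z. (norm (rep_l2_circle (X m) z - g z))\<^sup>2 \<partial>circle)" for m
    unfolding dist_l2_circle_power2
  proof (rule integral_cong_AE)
    show "AE z in circle. (norm (rep_l2_circle (X m) z - rep_l2_circle (abs_l2_circle g) z))\<^sup>2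
        = (norm (rep_l2_circle (X m) z - g z))\<^sup>2"
      using rep_abs_l2_circle[OF g(1)] by eventually_elim simp
  qed measurable
  have "X \<longlonglongrightarrow> abs_l2_circle g"
  proof (rule metric_LIMSEQ_I)
    fix r :: real assume "0 < r"
    then have "0 < (r/2)\<^sup>2" by simp
    then obtain N where N: "\<forall>m\<ge>N. (dist (X m) (abs_l2_circle g))\<^sup>2 \<le> (r/2)\<^sup>2"
      unfolding dist_eq using g(2) by blast
    have "dist (X m) (abs_l2_circle g) < r" if "m \<ge> N" for m
    proof -
      have "(dist (X m) (abs_l2_circle g))\<^sup>2 \<le> (r/2)\<^sup>2" using N that by blast
      then have "dist (X m) (abs_l2_circle g) \<le> r/2"
        by (rule power2_le_imp_le) (use \<open>0 < r\<close> in simp)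
      then show ?thesis using \<open>0 < r\<close> by simp
    qed
    then show "\<exists>N. \<forall>m\<ge>N. dist (X m) (abs_l2_circle g) < r" by blast
  qed
  then show "convergent X" by (rule convergentI)
qed

instantiation l2_circle :: complex_hilbert
begin

lift_definition cinner_l2_circle :: "l2_circle \<Rightarrow> l2_circle \<Rightarrow> complex"
  is "\<lambda>f g. \<integral>z. f z * cnj (g z) \<partial>circle"
  by (rule integral_mult_cnj_cong)

lift_definition scaleC_l2_circle :: "complex \<Rightarrow> l2_circle \<Rightarrow> l2_circle" is "\<lambda>a f z. a * f z"
  unfolding L2_rel_def by (auto intro: square_integrable_scale elim: eventually_mono)

instance
proof
  fix f g h :: l2_circle and r :: real and a b :: complex
  show "a *\<^sub>C (f + g) = a *\<^sub>C f + a *\<^sub>C g"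
    by transfer (simp add: L2_rel_def square_integrable_add square_integrable_scale distrib_left)
  show "(a + b) *\<^sub>C f = a *\<^sub>C f + b *\<^sub>C f"
    by transfer (simp add: L2_rel_def square_integrable_add square_integrable_scale distrib_right)
  show "a *\<^sub>C (b *\<^sub>C f) = (a * b) *\<^sub>C f"
    by transfer (simp add: L2_rel_def square_integrable_scale flip: mult.assoc)
  show "complex_of_real r *\<^sub>C f = r *\<^sub>R f"
    by transfer (simp add: L2_rel_def square_integrable_scale)
  show "cinner f g = cnj (cinner g f)"
    by transfer (rule integral_mult_cnj_commute)
  show "cinner (f + g) h = cinner f h + cinner g h"
    by transfer (simp add: L2_rel_def distrib_right integrable_mult_cnj)
  show "cinner (a *\<^sub>C f) g = a * cinner f g"
    by transfer (simp add: mult.assoc)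
  show "Re (cinner f g) = inner f g"
    by transfer (rule refl)
qed

end

text \<open>
  \<open>L2_class\<close> and \<open>mult_op\<close> take the value \<open>0\<close> by convention outside square-integrable functions and
  essentially bounded symbols, respectively. The symbols and the exponentials to which they are
  applied below all lie in these classes.
\<close>

lift_definition L2_class :: "(complex \<Rightarrow> complex) \<Rightarrow> l2_circle"
  is "\<lambda>f. if square_integrable f then f else (\<lambda>_. 0)"
  by (simp add: L2_rel_def square_integrable_zero)

lift_definition L2_cnj :: "l2_circle \<Rightarrow> l2_circle" is "\<lambda>f z. cnj (f z)"
  unfolding L2_rel_def by (auto intro: square_integrable_cnj elim: eventually_mono)

lift_definition mult_op :: "(complex \<Rightarrow> complex) \<Rightarrow> l2_circle \<Rightarrow> l2_circle"
  is "\<lambda>\<phi> f. if \<phi> \<in> Linf then (\<lambda>z. \<phi> z * f z) else (\<lambda>_. 0)"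
proof -
  fix \<phi> f g :: "complex \<Rightarrow> complex"
  assume fg: "L2_rel f g"
  show "L2_rel (if \<phi> \<in> Linf then (\<lambda>z. \<phi> z * f z) else (\<lambda>_. 0))
      (if \<phi> \<in> Linf then (\<lambda>z. \<phi> z * g z) else (\<lambda>_. 0))"
  proof (cases "\<phi> \<in> Linf")
    case True
    moreover from fg have "AE z in circle. f z = g z" by (simp add: L2_rel_def)
    then have "AE z in circle. \<phi> z * f z = \<phi> z * g z" by eventually_elim simp
    ultimately show ?thesis using fg by (simp add: L2_rel_def square_integrable_mult_Linf)
  qed (simp add: L2_rel_def square_integrable_zero)
qed

lemma coordinate_Linf: "(\<lambda>z. z) \<in> Linf"
proof -
  have "AE z in circle. norm z \<le> 1"
    using AE_circle_norm by eventually_elim simp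
  then show ?thesis by (auto simp: Linf_def)
qed

lemma square_integrable_Linf:
  assumes "\<phi> \<in> Linf"
  shows "square_integrable \<phi>"
proof -
  interpret finite_measure circle by (rule finite_measure_circle)
  have "square_integrable (\<lambda>_. 1)"
    by (simp add: square_integrable_def)
  from square_integrable_mult_Linf[OF assms this] show ?thesis by simp
qed

lemma powi_Linf: "(\<lambda>z. z powi n) \<in> Linf"
proof -
  have "AE z in circle. norm (z powi n) \<le> 1"
    using AE_circle_norm by eventually_elim (simp add: norm_power_int)
  moreover have "(\<lambda>z::complex. z powi n) \<in> borel_measurable circle"
    unfolding power_int_def by measurable
  ultimately show ?thesis by (auto simp: Linf_def)
qed

definition fourier_coeff :: "l2_circle \<Rightarrow> int \<Rightarrow> complex"
  where "fourier_coeff f n = cinner f (L2_class (\<lambda>z. z powi n))"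

text \<open>
  A function in the Hardy space of the disc is identified with its boundary function, so that
  its Taylor coefficients become the Fourier coefficients with index \<open>n \<ge> 0\<close>.
\<close>

definition hardy_space :: "l2_circle set"
  where "hardy_space = {f. \<forall>n<0. fourier_coeff f n = 0}"

text \<open>An inner function, too, is given by its boundary function.\<close>

definition inner_function :: "(complex \<Rightarrow> complex) \<Rightarrow> bool"
  where "inner_function u \<longleftrightarrow> u \<in> Linf \<and> L2_class u \<in> hardy_space \<and> (AE z in circle. norm (u z) = 1)"

definition model_space :: "(complex \<Rightarrow> complex) \<Rightarrow> l2_circle set"
  where "model_space u = {f \<in> hardy_space. \<forall>g \<in> mult_op u ` hardy_space. cinner f g = 0}"

definition truncated_toeplitz :: "(complex \<Rightarrow> complex) \<Rightarrow> (complex \<Rightarrow> complex) \<Rightarrow> l2_circle \<Rightarrow> l2_circle"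
  where "truncated_toeplitz u \<phi> = (\<lambda>f\<in>model_space u. orth_proj (model_space u) (mult_op \<phi> f))"

end

(*
  Write A for A_phi, S for A_z and k for the projection of cnj z * u onto K = K_u.  Then
  S f = z f - <f, k> u on K and I - S* S = k (x) k has rank one, so (A, S) is in AY_2 iff
  A - A* S = l (k (x) k) for a scalar l.  The symbol cnj c + c z solves this with l = cnj c, and
  bounded symbols in u H^2 + cnj (u H^2) induce the zero operator (test on the bounded elements
  of K, which are total); this gives "if" and the commutation.

  Conversely, subtracting l + cnj l * z from phi reduces to A = A* S.  Then A = S* A S, and
  expanding <A f, g> = <A S f, S g> at f = k and at g = k shows, via the conjugation
  f |-> u * cnj (z f) of K, that phi - b and cnj phi - a are orthogonal to K for some constants
  a, b.  Hence phi lies in d + u H^2 + cnj (u H^2) for a constant d, so A = d I.  Now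
  d k = cnj d * S k and norm (S k) < norm k force d = 0.
*)
theory Submission
  imports Defs
begin

section \<open>Complex Hilbert spaces\<close>

text \<open>A bounded symbol in u H^2 + cnj (u H^2) may split into two unbounded summands, and
  neither summand then defines an operator on its own; this is why vanishing of the induced operator
  is tested on bounded elements only. The identity A = S* A S comes from taking adjoints in A = A*
  S, which gives A* = S* A. Its value is that <\<phi> z f, z g> = <\<phi> f, g> cancels the main
  terms of the expansion and leaves only terms carrying <f, k> or <g, k>. Since <f, k> = <z f, u>,
  what remains is a statement about \<phi> u, and the conjugation of K turns it into one about
  \<phi> alone by cancelling u. The scalar l is the operator X itself: the defect space is the line
  through k, so X acts there as a number. Adjoint, square root and projection are definite
  descriptions, so each is identified by exhibiting a candidate and proving uniqueness; for the
  square root this is done by hand for a rank-one operator. Equality in L^2 is decided by Fourier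
  coefficients, hence the work on completeness of the exponentials.\<close>

lemma cinner_add_right: "cinner x (y + z) = cinner x y + cinner x (z::'a::complex_hilbert)"
  by (metis cinner_add_left cinner_commute complex_cnj_add)

lemma cinner_scaleC_right: "cinner x (a *\<^sub>C y) = cnj a * cinner x (y::'a::complex_hilbert)"
  by (metis cinner_commute cinner_scaleC_left complex_cnj_mult)

lemma scaleC_minus1: "(- 1) *\<^sub>C x = - (x::'a::complex_hilbert)"
  using scaleC_of_real[of "-1" x] by simp

lemma scaleC_one [simp]: "1 *\<^sub>C x = (x::'a::complex_hilbert)"
  using scaleC_of_real[of 1 x] by simp

lemma scaleC_zero_left [simp]: "0 *\<^sub>C x = (0::'a::complex_hilbert)"
  using scaleC_of_real[of 0 x] by simp

lemma scaleC_zero_right [simp]: "a *\<^sub>C 0 = (0::'a::complex_hilbert)"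
  using scaleC_add_right[of a 0 0] by simp

lemma scaleC_minus_right: "a *\<^sub>C (- x) = - (a *\<^sub>C (x::'a::complex_hilbert))"
  using scaleC_add_right[of a x "-x"] by (simp add: eq_neg_iff_add_eq_0 add.commute)

lemma scaleC_diff_right: "a *\<^sub>C (x - y) = a *\<^sub>C x - a *\<^sub>C (y::'a::complex_hilbert)"
  using scaleC_add_right[of a x "-y"] by (simp add: scaleC_minus_right)

lemma cinner_minus_left: "cinner (- x) y = - cinner x (y::'a::complex_hilbert)"
  using cinner_scaleC_left[of "-1" x y] by (simp add: scaleC_minus1)

lemma cinner_minus_right: "cinner x (- y) = - cinner x (y::'a::complex_hilbert)"
  using cinner_scaleC_right[of x "-1" y] by (simp add: scaleC_minus1)

lemma cinner_diff_left: "cinner (x - y) z = cinner x z - cinner y (z::'a::complex_hilbert)"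
  using cinner_add_left[of x "-y" z] by (simp add: cinner_minus_left)

lemma cinner_diff_right: "cinner x (y - z) = cinner x y - cinner x (z::'a::complex_hilbert)"
  using cinner_add_right[of x y "-z"] by (simp add: cinner_minus_right)

lemma cinner_zero_left [simp]: "cinner 0 (x::'a::complex_hilbert) = 0"
  using cinner_diff_left[of 0 0 x] by simp

lemma cinner_zero_right [simp]: "cinner (x::'a::complex_hilbert) 0 = 0"
  using cinner_diff_right[of x 0 0] by simp

lemmas cinner_simps = cinner_add_left cinner_add_right cinner_diff_left cinner_diff_right
  cinner_scaleC_left cinner_scaleC_right cinner_minus_left cinner_minus_right

lemma cinner_self: "cinner x x = complex_of_real ((norm (x::'a::complex_hilbert))\<^sup>2)"
proof (rule complex_eqI)
  show "Re (cinner x x) = Re (complex_of_real ((norm x)\<^sup>2))"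
    by (simp add: Re_cinner power2_norm_eq_inner)
  show "Im (cinner x x) = Im (complex_of_real ((norm x)\<^sup>2))"
    using cinner_commute[of x x] by (metis Im_complex_of_real Reals_cnj_iff complex_is_Real_iff)
qed

lemma cinner_self_eq_0 [simp]: "cinner x x = 0 \<longleftrightarrow> (x::'a::complex_hilbert) = 0"
  by (simp add: cinner_self)

lemma Im_cinner: "Im (cinner x y) = inner x (\<i> *\<^sub>C (y::'a::complex_hilbert))"
  by (simp flip: Re_cinner add: cinner_scaleC_right)

lemma continuous_on_cinner_left [continuous_intros]: "continuous_on A (\<lambda>x. cinner x (y::'a::complex_hilbert))"
proof -
  have "cinner x y = complex_of_real (inner x y) + \<i> * complex_of_real (inner x (\<i> *\<^sub>C y))" for x
    by (simp add: complex_eq_iff Re_cinner Im_cinner)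
  then show ?thesis by (auto intro!: continuous_intros)
qed

lemma norm_scaleC: "norm (a *\<^sub>C x) = cmod a * norm (x::'a::complex_hilbert)"
proof -
  have "complex_of_real ((norm (a *\<^sub>C x))\<^sup>2) = a * cnj a * cinner x x"
    by (simp only: cinner_self[symmetric] cinner_scaleC_left cinner_scaleC_right mult_ac)
  also have "\<dots> = complex_of_real ((cmod a * norm x)\<^sup>2)"
    by (simp add: cinner_self power_mult_distrib flip: complex_norm_square)
  finally have "(norm (a *\<^sub>C x))\<^sup>2 = (cmod a * norm x)\<^sup>2" by (simp only: of_real_eq_iff)
  then show ?thesis by (simp add: power2_eq_iff_nonneg)
qed

lemma cmod_cinner_le: "cmod (cinner x y) \<le> norm x * norm (y::'a::complex_hilbert)"
proof -
  \<comment> \<open>This unimodular factor rotates the inner product onto the nonnegative real axis,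
    where the real Cauchy-Schwarz inequality applies.\<close>
  define a where "a = cis (- Arg (cinner x y))"
  have a: "cmod a = 1" "a * cinner x y = complex_of_real (cmod (cinner x y))"
    using arg_cong[OF rcis_cmod_Arg[of "cinner x y"], of "\<lambda>z. a * z"]
    by (auto simp: a_def rcis_def cis_mult mult.left_commute)
  have "cmod (cinner x y) = inner (a *\<^sub>C x) y"
    by (simp flip: Re_cinner add: cinner_simps a)
  also have "\<dots> \<le> norm (a *\<^sub>C x) * norm y" by (rule norm_cauchy_schwarz)
  finally show ?thesis by (simp add: norm_scaleC a)
qed

section \<open>Complex subspaces, orthogonal complements and projections\<close>

definition csubspace :: "'a::complex_hilbert set \<Rightarrow> bool"
  where "csubspace K \<longleftrightarrow> 0 \<in> K \<and> (\<forall>x\<in>K. \<forall>y\<in>K. x + y \<in> K) \<and> (\<forall>a. \<forall>x\<in>K. a *\<^sub>C x \<in> K)"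

definition orth_compl :: "'a::complex_hilbert set \<Rightarrow> 'a set"
  where "orth_compl M = {x. \<forall>y\<in>M. cinner x y = 0}"

lemma csubspace_0: "csubspace K \<Longrightarrow> 0 \<in> K"
  and csubspace_add: "csubspace K \<Longrightarrow> x \<in> K \<Longrightarrow> y \<in> K \<Longrightarrow> x + y \<in> K"
  and csubspace_scaleC: "csubspace K \<Longrightarrow> x \<in> K \<Longrightarrow> a *\<^sub>C x \<in> K"
  by (auto simp: csubspace_def)

lemma csubspace_diff: "csubspace K \<Longrightarrow> x \<in> K \<Longrightarrow> y \<in> K \<Longrightarrow> x - y \<in> K"
  using csubspace_add[of K x "(-1) *\<^sub>C y"] csubspace_scaleC[of K y "-1"] by (simp add: scaleC_minus1)

lemma csubspace_orth_compl: "csubspace (orth_compl M)"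
  by (simp add: csubspace_def orth_compl_def cinner_simps)

lemma closed_orth_compl: "closed (orth_compl M)"
proof -
  have "orth_compl M = (\<Inter>y\<in>M. {x. cinner x y = 0})" by (auto simp: orth_compl_def)
  moreover have "closed {x. cinner x y = 0}" for y :: 'a
    by (intro closed_Collect_eq continuous_intros)
  ultimately show ?thesis by auto
qed

text \<open>Writing a line as a double orthogonal complement shows at once that it is a closed
  complex subspace. The defect space of the compressed shift is such a line.\<close>

lemma range_scaleC_eq: "range (\<lambda>a. a *\<^sub>C v) = orth_compl (orth_compl {v::'a::complex_hilbert})"
proof (intro equalityI subsetI)
  fix x assume "x \<in> range (\<lambda>a. a *\<^sub>C v)"
  then show "x \<in> orth_compl (orth_compl {v})"
    by (auto simp: orth_compl_def cinner_simps cinner_commute[of v])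
next
  fix x assume x: "x \<in> orth_compl (orth_compl {v})"
  define w where "w = x - (cinner x v / cinner v v) *\<^sub>C v"
  have wv: "cinner w v = 0" by (simp add: w_def cinner_simps)
  then have "cinner x w = 0" "cinner v w = 0"
    using x by (auto simp: orth_compl_def cinner_commute[of v])
  then have "cinner (x - (cinner x v / cinner v v) *\<^sub>C v) w = 0"
    by (simp only: cinner_diff_left cinner_scaleC_left) simp
  then have "cinner w w = 0" by (simp only: w_def)
  then have "x = (cinner x v / cinner v v) *\<^sub>C v" by (simp add: w_def)
  then show "x \<in> range (\<lambda>a. a *\<^sub>C v)" by blast
qed

text \<open>With \<open>M\<close> the line through the defect vector, this is the operator
  \<open>X\<close> that realises a prescribed scalar in the Agler-Young condition.\<close>

lemma scaleC_bounded_ops: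
  assumes "csubspace M"
  shows "(\<lambda>x\<in>M. a *\<^sub>C x) \<in> bounded_ops M"
proof -
  have "\<exists>C. \<forall>x\<in>M. norm (a *\<^sub>C x) \<le> C * norm x"
    by (intro exI[of _ "cmod a"]) (simp add: norm_scaleC)
  then show ?thesis
    using csubspace_add[OF assms] csubspace_scaleC[OF assms]
    by (auto simp: bounded_ops_def scaleC_add_right scaleC_scaleC mult.commute)
qed

lemma subspace_nearest_point:
  fixes K :: "'a::{real_inner, complete_space} set"
  assumes "closed K" "subspace K"
  shows "\<exists>y\<in>K. \<forall>k\<in>K. norm (x - y) \<le> norm (x - k)"
proof -
  define d where "d = infdist x K"
  have ne: "K \<noteq> {}" using assms(2) subspace_0 by blast
  have lb: "d \<le> norm (x - k)" if "k \<in> K" for k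
    unfolding d_def using infdist_le[OF that, of x] by (simp add: dist_norm)
  have d0: "0 \<le> d" by (simp add: d_def infdist_nonneg)
  have "\<exists>y\<in>K. norm (x - y) < d + inverse (real (Suc n))" for n
  proof (rule ccontr)
    assume "\<not> ?thesis"
    then have "d + inverse (real (Suc n)) \<le> infdist x K"
      unfolding infdist_def using ne by (auto intro!: cINF_greatest simp: dist_norm not_less)
    then show False by (simp add: d_def)
  qed
  then obtain y where y: "\<And>n. y n \<in> K" "\<And>n. norm (x - y n) < d + inverse (real (Suc n))"
    by metis
  have lim: "(\<lambda>n. norm (x - y n)) \<longlonglongrightarrow> d"
  proof (rule tendsto_sandwich[of "\<lambda>_. d" _ _ "\<lambda>n. d + inverse (real (Suc n))"])
    show "(\<lambda>n. d + inverse (real (Suc n))) \<longlonglongrightarrow> d"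
      using tendsto_add[OF tendsto_const[of d] LIMSEQ_inverse_real_of_nat] by simp
  qed (use y lb in \<open>auto intro!: always_eventually less_imp_le simp del: of_nat_Suc\<close>)
  \<comment> \<open>The midpoint of \<open>y m\<close> and \<open>y n\<close> lies in
    \<open>K\<close>, so its distance to \<open>x\<close> is at least \<open>d\<close>; the
    parallelogram law then bounds the gap between two almost nearest points.\<close>
  have par: "(norm (y m - y n))\<^sup>2 \<le> 2 * ((norm (x - y m))\<^sup>2 - d\<^sup>2) + 2 * ((norm (x - y n))\<^sup>2 - d\<^sup>2)" for m n
  proof -
    have "(1/2) *\<^sub>R (y m + y n) \<in> K"
      using assms(2) y(1) by (intro subspace_scale subspace_add)
    from lb[OF this] have "d\<^sup>2 \<le> (norm (x - (1/2) *\<^sub>R (y m + y n)))\<^sup>2"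
      using d0 by (rule power_mono)
    moreover have "4 * (norm (x - (1/2) *\<^sub>R (y m + y n)))\<^sup>2 + (norm (y m - y n))\<^sup>2
        = 2 * (norm (x - y m))\<^sup>2 + 2 * (norm (x - y n))\<^sup>2"
      by (simp add: power2_norm_eq_inner inner_simps inner_commute algebra_simps)
    ultimately show ?thesis by argo
  qed
  have "Cauchy y"
  proof (rule metric_CauchyI)
    fix e :: real assume e: "0 < e"
    have "(\<lambda>n. (norm (x - y n))\<^sup>2 - d\<^sup>2) \<longlonglongrightarrow> d\<^sup>2 - d\<^sup>2" by (intro tendsto_intros lim)
    then have "\<forall>\<^sub>F n in sequentially. (norm (x - y n))\<^sup>2 - d\<^sup>2 < e\<^sup>2 / 4"
      using e by (intro order_tendstoD) auto
    then obtain N where N: "\<And>n. n \<ge> N \<Longrightarrow> (norm (x - y n))\<^sup>2 - d\<^sup>2 < e\<^sup>2 / 4"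
      by (auto simp: eventually_sequentially)
    have "dist (y m) (y n) < e" if "m \<ge> N" "n \<ge> N" for m n
    proof -
      have "(norm (y m - y n))\<^sup>2 < e\<^sup>2" using par[of m n] N[OF that(1)] N[OF that(2)] by argo
      then show ?thesis using e by (simp add: dist_norm power_less_imp_less_base)
    qed
    then show "\<exists>M. \<forall>m\<ge>M. \<forall>n\<ge>M. dist (y m) (y n) < e" by blast
  qed
  then obtain l where l: "y \<longlonglongrightarrow> l" using Cauchy_convergent convergent_def by blast
  have "l \<in> K" using closed_sequentially[OF assms(1) y(1) l] .
  moreover have "norm (x - l) = d"
    by (rule LIMSEQ_unique[OF _ lim]) (intro tendsto_intros l)
  ultimately show ?thesis using lb by auto
qed

lemma orth_proj_exists:
  fixes K :: "'a::complex_hilbert set"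
  assumes "closed K" "csubspace K"
  shows "\<exists>y\<in>K. \<forall>k\<in>K. cinner (x - y) k = 0"
proof -
  have "subspace K"
    using assms(2) by (auto simp: csubspace_def subspace_def simp flip: scaleC_of_real)
  then obtain y where y: "y \<in> K" "\<And>k. k \<in> K \<Longrightarrow> norm (x - y) \<le> norm (x - k)"
    using subspace_nearest_point[OF assms(1)] by blast
  have "cinner (x - y) k = 0" if k: "k \<in> K" for k
  proof (cases "k = 0")
    case False
    \<comment> \<open>The coefficient of the component of \<open>x - y\<close> along
      \<open>k\<close>: moving \<open>y\<close> by \<open>t *\<^sub>C k\<close> lowers the squared
      distance by exactly |t|^2 |k|^2, so minimality forces \<open>t = 0\<close>.\<close>
    define t where "t = cinner (x - y) k / cinner k k"
    have kk: "cinner k k \<noteq> 0" using False by simp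
    have "y + t *\<^sub>C k \<in> K" using assms(2) y(1) k by (intro csubspace_add csubspace_scaleC)
    from y(2)[OF this] have "(norm (x - y))\<^sup>2 \<le> (norm (x - y - t *\<^sub>C k))\<^sup>2"
      by (simp add: power_mono diff_diff_eq)
    moreover have "cinner (x - y - t *\<^sub>C k) (x - y - t *\<^sub>C k)
        = cinner (x - y) (x - y) - t * cnj t * cinner k k"
    proof -
      have a: "cinner (x - y) k = t * cinner k k" using kk by (simp add: t_def)
      have "cinner k k = cnj (cinner k k)" by (rule cinner_commute)
      then have b: "cinner k (x - y) = cnj t * cinner k k"
        by (subst cinner_commute) (simp add: a)
      show ?thesis
        by (simp only: cinner_diff_left[of "x - y"] cinner_diff_right[of _ "x - y"]
            cinner_scaleC_left cinner_scaleC_right a b) (simp add: algebra_simps)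
    qed
    then have "complex_of_real ((norm (x - y - t *\<^sub>C k))\<^sup>2)
        = complex_of_real ((norm (x - y))\<^sup>2 - (cmod t)\<^sup>2 * (norm k)\<^sup>2)"
      by (simp add: cinner_self flip: complex_norm_square)
    then have "(norm (x - y - t *\<^sub>C k))\<^sup>2 = (norm (x - y))\<^sup>2 - (cmod t)\<^sup>2 * (norm k)\<^sup>2"
      by (simp only: of_real_eq_iff)
    ultimately have "(cmod t)\<^sup>2 * (norm k)\<^sup>2 \<le> 0" by linarith
    then have "t = 0" using False by (auto simp: mult_le_0_iff)
    then show ?thesis using kk by (simp add: t_def)
  qed simp
  with y show ?thesis by blast
qed

lemma orth_proj_eqI:
  assumes "csubspace K" "y \<in> K" "\<And>k. k \<in> K \<Longrightarrow> cinner (x - y) k = 0"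
  shows "orth_proj K x = y"
  unfolding orth_proj_def
proof (rule the_equality)
  fix y' assume y': "y' \<in> K \<and> (\<forall>k\<in>K. cinner (x - y') k = 0)"
  have "y' - y \<in> K" using csubspace_diff assms y' by blast
  then have "cinner (x - y) (y' - y) - cinner (x - y') (y' - y) = 0" using assms y' by simp
  then have "cinner (y' - y) (y' - y) = 0" by (simp add: cinner_simps algebra_simps)
  then show "y' = y" by simp
qed (use assms in auto)

lemma orth_proj_props:
  assumes "closed K" "csubspace K"
  shows "orth_proj K x \<in> K" "k \<in> K \<Longrightarrow> cinner (orth_proj K x) k = cinner x k"
    "k \<in> K \<Longrightarrow> cinner k (orth_proj K x) = cinner k x"
proof -
  obtain y where y: "y \<in> K" "\<And>k. k \<in> K \<Longrightarrow> cinner (x - y) k = 0"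
    using orth_proj_exists[OF assms] by blast
  have e: "orth_proj K x = y" using orth_proj_eqI[OF assms(2)] y by blast
  show "orth_proj K x \<in> K" using y e by simp
  have *: "k \<in> K \<Longrightarrow> cinner (orth_proj K x) k = cinner x k" for k
    using y(2)[of k] e by (simp add: cinner_simps)
  then show "k \<in> K \<Longrightarrow> cinner (orth_proj K x) k = cinner x k" .
  show "k \<in> K \<Longrightarrow> cinner k (orth_proj K x) = cinner k x"
    using * by (metis cinner_commute)
qed

lemma orth_proj_add:
  assumes "closed K" "csubspace K"
  shows "orth_proj K (x + y) = orth_proj K x + orth_proj K y"
  by (rule orth_proj_eqI)
    (use assms in \<open>auto simp: csubspace_add cinner_simps orth_proj_props\<close>)

lemma orth_proj_scaleC:
  assumes "closed K" "csubspace K"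
  shows "orth_proj K (a *\<^sub>C x) = a *\<^sub>C orth_proj K x"
  by (rule orth_proj_eqI)
    (use assms in \<open>auto simp: csubspace_scaleC cinner_simps orth_proj_props\<close>)

lemma orth_proj_id: "csubspace K \<Longrightarrow> x \<in> K \<Longrightarrow> orth_proj K x = x"
  by (rule orth_proj_eqI) auto

lemma norm_orth_proj_le:
  assumes "closed K" "csubspace K"
  shows "norm (orth_proj K x) \<le> norm x"
proof -
  define p where "p = orth_proj K x"
  have "inner p p = inner x p"
    using orth_proj_props(2)[OF assms orth_proj_props(1)[OF assms], of x x] 
    by (simp add: p_def flip: Re_cinner)
  then have "norm p * norm p \<le> norm x * norm p"
    using norm_cauchy_schwarz[of x p] by (simp flip: power2_norm_eq_inner power2_eq_square)
  then show ?thesis unfolding p_def[symmetric]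
    by (cases "p = 0") (auto simp del: mult_le_cancel_right dest: mult_right_le_imp_le)
qed

lemma eq_if_cinner_eq:
  assumes "csubspace K" "x \<in> K" "y \<in> K" "\<And>k. k \<in> K \<Longrightarrow> cinner x k = cinner y k"
  shows "x = y"
proof -
  have "cinner (x - y) (x - y) = 0"
    using assms(4)[OF csubspace_diff[OF assms(1-3)]] by (simp add: cinner_diff_left)
  then show ?thesis by simp
qed

section \<open>Adjoints, positive operators and the square root of a rank-one operator\<close>

lemma adjoint_op_eqI:
  assumes K: "csubspace K" and S: "S \<in> bounded_ops K"
    and adj: "\<And>x y. x \<in> K \<Longrightarrow> y \<in> K \<Longrightarrow> cinner (T x) y = cinner x (S y)"
  shows "adjoint_op K T = S"
  unfolding adjoint_op_def
proof (rule the_equality)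
  fix S' assume S': "S' \<in> bounded_ops K \<and> (\<forall>x\<in>K. \<forall>y\<in>K. cinner (T x) y = cinner x (S' y))"
  have "S' y = S y" if y: "y \<in> K" for y
  proof (rule eq_if_cinner_eq[OF K])
    show "S' y \<in> K" "S y \<in> K" using S S' y by (auto simp: bounded_ops_def)
    show "cinner (S' y) k = cinner (S y) k" if "k \<in> K" for k
      using S' adj[OF that y] y that by (metis cinner_commute)
  qed
  then show "S' = S" using S S' by (auto simp: bounded_ops_def intro: PiE_ext)
qed (use S adj in auto)

text \<open>Polarisation: the quadratic form is real at \<open>x + y\<close>, which relates the
  imaginary parts of <R x, y> and <R y, x>; replacing \<open>x\<close> by i x gives the real
  parts.\<close>

lemma positive_op_self_adjoint:
  assumes K: "csubspace K" and R: "positive_op K R" and x: "x \<in> K" and y: "y \<in> K"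
  shows "cinner (R x) y = cinner x (R y)"
proof -
  have add: "R (x + y) = R x + R y" if "x \<in> K" "y \<in> K" for x y
    using R that by (auto simp: positive_op_def bounded_ops_def)
  have sc: "R (a *\<^sub>C x) = a *\<^sub>C R x" if "x \<in> K" for x a
    using R that by (auto simp: positive_op_def bounded_ops_def)
  have real: "Im (cinner (R x) x) = 0" if "x \<in> K" for x
    using R that by (auto simp: positive_op_def complex_is_Real_iff)
  have 1: "Im (cinner (R x) y) + Im (cinner (R y) x) = 0" if "x \<in> K" "y \<in> K" for x y
    using real[of "x + y"] real[of x] real[of y] that
    by (simp add: add cinner_simps csubspace_add[OF K])
  have 2: "Re (cinner (R x) y) = Re (cinner (R y) x)"
    using 1[OF csubspace_scaleC[OF K x, of \<i>] y] x y by (simp add: sc cinner_simps)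
  have "cinner (R x) y = cnj (cinner (R y) x)"
    using 1[OF x y] 2 by (simp add: complex_eq_iff)
  then show ?thesis by (subst cinner_commute[of x]) simp
qed

text \<open>Uniqueness needs no spectral theory in rank one. If R is a positive root of P, then |R
  x|^2 = <P x, x>, so R vanishes on the vectors orthogonal to \<open>v\<close> and is determined by
  \<open>R v\<close>. Self-adjointness makes \<open>v\<close> an eigenvector, and squaring together
  with positivity fixes the eigenvalue as \<open>norm v\<close>.\<close>

lemma sqrt_op_rank_one:
  fixes v :: "'a::complex_hilbert"
  assumes K: "csubspace K" and v: "v \<in> K" "v \<noteq> 0"
    and P: "\<And>x. x \<in> K \<Longrightarrow> P x = cinner x v *\<^sub>C v"
  shows "sqrt_op K P = (\<lambda>x\<in>K. (cinner x v / complex_of_real (norm v)) *\<^sub>C v)"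
  unfolding sqrt_op_def
proof (rule the_equality)
  let ?R = "\<lambda>x\<in>K. (cinner x v / complex_of_real (norm v)) *\<^sub>C v"
  have vv: "cinner v v = complex_of_real (norm v) * complex_of_real (norm v)"
    by (simp add: cinner_self power2_eq_square)
  have n0: "complex_of_real (norm v) \<noteq> 0" using v by simp
  have pos: "cinner (?R x) x = complex_of_real ((cmod (cinner x v))\<^sup>2 / norm v)" if "x \<in> K" for x
    using that by (simp add: cinner_simps cinner_commute[of v x] flip: complex_norm_square)
  have "?R \<in> bounded_ops K"
    unfolding bounded_ops_def
  proof (intro CollectI conjI ballI allI)
    show "?R \<in> K \<rightarrow>\<^sub>E K" using K v by (auto intro: csubspace_scaleC)
    show "\<exists>C. \<forall>x\<in>K. norm (?R x) \<le> C * norm x"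
      using cmod_cinner_le[of _ v] v by (intro exI[of _ "norm v"]) (auto simp: norm_scaleC norm_divide mult.commute)
  qed (use K in \<open>auto simp: csubspace_add csubspace_scaleC cinner_simps scaleC_add_left scaleC_scaleC add_divide_distrib\<close>)
  then show "positive_op K ?R \<and> (\<forall>x\<in>K. ?R (?R x) = P x)"
    unfolding positive_op_def using pos n0
    by (auto simp: P cinner_simps scaleC_scaleC vv csubspace_scaleC[OF K v(1)] simp del: restrict_apply)
      (auto simp: P cinner_simps scaleC_scaleC vv csubspace_scaleC[OF K v(1)])
  fix R assume "positive_op K R \<and> (\<forall>x\<in>K. R (R x) = P x)"
  then have R: "positive_op K R" and sq: "\<And>x. x \<in> K \<Longrightarrow> R (R x) = P x" by auto
  have RK: "R x \<in> K" if "x \<in> K" for x using R that by (auto simp: positive_op_def bounded_ops_def)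
  have add: "R (x + y) = R x + R y" if "x \<in> K" "y \<in> K" for x y
    using R that by (auto simp: positive_op_def bounded_ops_def)
  have sc: "R (a *\<^sub>C x) = a *\<^sub>C R x" if "x \<in> K" for x a
    using R that by (auto simp: positive_op_def bounded_ops_def)
  have ker: "R x = 0" if "x \<in> K" "cinner x v = 0" for x
  proof -
    have "cinner (R x) (R x) = cinner (R (R x)) x"
      by (rule positive_op_self_adjoint[OF K R RK[OF that(1)] that(1), symmetric])
    also have "\<dots> = 0" using that by (simp add: sq P)
    finally show ?thesis by simp
  qed
  have dec: "R x = (cinner x v / cinner v v) *\<^sub>C R v" if x: "x \<in> K" for x
  proof -
    define w where "w = x - (cinner x v / cinner v v) *\<^sub>C v"
    have "w \<in> K" unfolding w_def by (intro csubspace_diff csubspace_scaleC K x v)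
    moreover have "cinner w v = 0" using v by (simp add: w_def cinner_simps)
    ultimately have "R (w + (cinner x v / cinner v v) *\<^sub>C v) = (cinner x v / cinner v v) *\<^sub>C R v"
      using ker by (simp add: add sc csubspace_scaleC K v)
    then show ?thesis by (simp add: w_def)
  qed
  \<comment> \<open>The only possible eigenvalue, read off by pairing \<open>R v\<close> with
    \<open>v\<close>.\<close>
  define m where "m = cinner (R v) v / cinner v v"
  have Rv: "R v = m *\<^sub>C v"
  proof (rule eq_if_cinner_eq[OF K RK[OF v(1)] csubspace_scaleC[OF K v(1)]])
    fix k assume k: "k \<in> K"
    have "cinner (R v) k = cinner v (R k)" by (rule positive_op_self_adjoint[OF K R v(1) k])
    also have "\<dots> = cnj (cinner k v / cinner v v) * cinner v (R v)"
      by (simp add: dec[OF k] cinner_simps)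
    also have "cinner v (R v) = cinner (R v) v" by (rule positive_op_self_adjoint[OF K R v(1) v(1), symmetric])
    finally show "cinner (R v) k = cinner (m *\<^sub>C v) k"
      by (simp add: m_def cinner_simps cinner_commute[of v k] cinner_self)
  qed
  \<comment> \<open>Positivity of \<open>R\<close> is used here: it selects the nonnegative one of
    the two roots of m^2 = |v|^2.\<close>
  obtain r where r: "m = complex_of_real r" "0 \<le> r"
  proof -
    have "cinner (R v) v \<in> \<real>" "0 \<le> Re (cinner (R v) v)"
      using R v by (auto simp: positive_op_def)
    then have "m = complex_of_real (Re (cinner (R v) v) / (norm v)\<^sup>2)"
      by (simp add: m_def cinner_self)
    then show ?thesis
      using \<open>0 \<le> Re (cinner (R v) v)\<close> by (intro that[of "Re (cinner (R v) v) / (norm v)\<^sup>2"]) auto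
  qed
  have "(m * m) *\<^sub>C v = cinner v v *\<^sub>C v"
    using sq[OF v(1)] v by (simp add: Rv sc P scaleC_scaleC)
  then have "cinner ((m * m) *\<^sub>C v) v = cinner (cinner v v *\<^sub>C v) v" by simp
  then have "m * m = cinner v v" using v by (simp add: cinner_simps)
  then have "r * r = norm v * norm v" unfolding r vv by (simp only: of_real_mult[symmetric] of_real_eq_iff)
  then have "r = norm v" using r(2) by (simp add: power2_eq_iff_nonneg flip: power2_eq_square)
  show "R = ?R"
  proof (rule PiE_ext)
    show "R \<in> K \<rightarrow>\<^sub>E K" using R by (auto simp: positive_op_def bounded_ops_def)
    show "?R \<in> K \<rightarrow>\<^sub>E K" using \<open>?R \<in> bounded_ops K\<close> by (auto simp: bounded_ops_def)
    show "R x = ?R x" if "x \<in> K" for x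
      using that n0 by (simp add: dec Rv scaleC_scaleC r \<open>r = norm v\<close> vv)
  qed
qed

section \<open>Multiplication operators and Fourier coefficients\<close>

lemma LinfD: "\<phi> \<in> Linf \<Longrightarrow> \<phi> \<in> borel_measurable borel"
  by (auto simp: Linf_def cong: measurable_cong_sets)

lemma LinfI: "\<phi> \<in> borel_measurable borel \<Longrightarrow> AE z in circle. norm (\<phi> z) \<le> C \<Longrightarrow> \<phi> \<in> Linf"
  by (auto simp: Linf_def cong: measurable_cong_sets)

lemma Linf_mult: "\<phi> \<in> Linf \<Longrightarrow> \<psi> \<in> Linf \<Longrightarrow> (\<lambda>z. \<phi> z * \<psi> z) \<in> Linf"
proof -
  assume *: "\<phi> \<in> Linf" "\<psi> \<in> Linf"
  then obtain C D where "AE z in circle. norm (\<phi> z) \<le> C" "AE z in circle. norm (\<psi> z) \<le> D"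
    by (auto simp: Linf_def)
  then have "AE z in circle. norm (\<phi> z * \<psi> z) \<le> C * D"
    by eventually_elim (simp add: norm_mult mult_mono order_trans[OF norm_ge_zero])
  then show ?thesis using * by (intro LinfI[OF borel_measurable_times[OF LinfD LinfD]])
qed

lemma Linf_add: "\<phi> \<in> Linf \<Longrightarrow> \<psi> \<in> Linf \<Longrightarrow> (\<lambda>z. \<phi> z + \<psi> z) \<in> Linf"
proof -
  assume *: "\<phi> \<in> Linf" "\<psi> \<in> Linf"
  then obtain C D where "AE z in circle. norm (\<phi> z) \<le> C" "AE z in circle. norm (\<psi> z) \<le> D"
    by (auto simp: Linf_def)
  then have "AE z in circle. norm (\<phi> z + \<psi> z) \<le> C + D"
    by eventually_elim (rule order_trans[OF norm_triangle_ineq add_mono])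
  then show ?thesis using * by (intro LinfI[OF borel_measurable_add[OF LinfD LinfD]])
qed

lemma Linf_cnj: "\<phi> \<in> Linf \<Longrightarrow> (\<lambda>z. cnj (\<phi> z)) \<in> Linf"
  by (auto simp: Linf_def intro: measurable_compose[OF _ measurable_cnj])

lemma Linf_diff: "\<phi> \<in> Linf \<Longrightarrow> \<psi> \<in> Linf \<Longrightarrow> (\<lambda>z. \<phi> z - \<psi> z) \<in> Linf"
  using Linf_add[OF _ Linf_mult[OF const_Linf[of "-1"]], of \<phi> \<psi>] by simp

lemma Linf_sum: "(\<And>i. i \<in> I \<Longrightarrow> f i \<in> Linf) \<Longrightarrow> (\<lambda>z. \<Sum>i\<in>I. f i z) \<in> Linf"
proof (induction I rule: infinite_finite_induct)
qed (auto intro: const_Linf Linf_add)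

lemmas Linf_intros = Linf_mult Linf_add Linf_diff Linf_cnj Linf_sum const_Linf powi_Linf coordinate_Linf

lemma mult_op_add: "mult_op \<phi> (f + g) = mult_op \<phi> f + mult_op \<phi> g"
  by transfer (auto simp: L2_rel_def square_integrable_zero distrib_left
      intro: square_integrable_add square_integrable_mult_Linf)

lemma mult_op_scaleC: "mult_op \<phi> (a *\<^sub>C f) = a *\<^sub>C mult_op \<phi> f"
  by transfer (auto simp: L2_rel_def square_integrable_zero mult.left_commute
      intro: square_integrable_scale square_integrable_mult_Linf)

lemma mult_op_minus: "mult_op \<phi> (- f) = - mult_op \<phi> f"
  using mult_op_scaleC[of \<phi> "-1" f] by (simp add: scaleC_minus1)

lemma mult_op_diff: "mult_op \<phi> (f - g) = mult_op \<phi> f - mult_op \<phi> g"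
  using mult_op_add[of \<phi> f "-g"] by (simp add: mult_op_minus)

lemma mult_op_mult:
  "\<phi> \<in> Linf \<Longrightarrow> \<psi> \<in> Linf \<Longrightarrow> mult_op \<phi> (mult_op \<psi> f) = mult_op (\<lambda>z. \<phi> z * \<psi> z) f"
  by transfer (auto simp: L2_rel_def Linf_mult mult.assoc intro: square_integrable_mult_Linf)

lemma mult_op_symbol_add:
  "\<phi> \<in> Linf \<Longrightarrow> \<psi> \<in> Linf \<Longrightarrow> mult_op (\<lambda>z. \<phi> z + \<psi> z) f = mult_op \<phi> f + mult_op \<psi> f"
  by transfer (auto simp: L2_rel_def Linf_add distrib_right
      intro: square_integrable_mult_Linf square_integrable_add)

lemma mult_op_const: "mult_op (\<lambda>_. c) f = c *\<^sub>C f"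
  by transfer (auto simp: L2_rel_def const_Linf intro: square_integrable_scale)

lemma mult_op_symbol_scale: "\<phi> \<in> Linf \<Longrightarrow> mult_op (\<lambda>z. c * \<phi> z) f = c *\<^sub>C mult_op \<phi> f"
  by (simp add: mult_op_mult[OF const_Linf, symmetric] mult_op_const)

lemma mult_op_symbol_diff:
  "\<phi> \<in> Linf \<Longrightarrow> \<psi> \<in> Linf \<Longrightarrow> mult_op (\<lambda>z. \<phi> z - \<psi> z) f = mult_op \<phi> f - mult_op \<psi> f"
  using mult_op_symbol_add[OF _ Linf_mult[OF const_Linf[of "-1"]], of \<phi> \<psi> f]
    mult_op_symbol_scale[of \<psi> "-1" f] by (simp add: scaleC_minus1)

lemma mult_op_cong_AE:
  assumes "\<phi> \<in> Linf" "\<psi> \<in> Linf" "AE z in circle. \<phi> z = \<psi> z"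
  shows "mult_op \<phi> f = mult_op \<psi> f"
  using assms
proof transfer
  fix \<phi> \<psi> f
  assume *: "\<phi> \<in> Linf" "\<psi> \<in> Linf" "AE z in circle. \<phi> z = \<psi> z" "L2_rel f f"
  have "AE z in circle. \<phi> z * f z = \<psi> z * f z" using *(3) by eventually_elim simp
  with * show "L2_rel (if \<phi> \<in> Linf then \<lambda>z. \<phi> z * f z else (\<lambda>_. 0))
        (if \<psi> \<in> Linf then \<lambda>z. \<psi> z * f z else (\<lambda>_. 0))"
    by (auto simp: L2_rel_def intro: square_integrable_mult_Linf)
qed

lemma cinner_mult_op:
  "\<phi> \<in> Linf \<Longrightarrow> cinner (mult_op \<phi> f) g = cinner f (mult_op (\<lambda>z. cnj (\<phi> z)) g)"
  by transfer (auto simp: Linf_cnj mult_ac)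

lemma mult_op_unimodular:
  assumes "\<phi> \<in> Linf" "AE z in circle. norm (\<phi> z) = 1"
  shows "mult_op (\<lambda>z. cnj (\<phi> z)) (mult_op \<phi> f) = f" "mult_op \<phi> (mult_op (\<lambda>z. cnj (\<phi> z)) f) = f"
proof -
  have *: "AE z in circle. cnj (\<phi> z) * \<phi> z = 1" "AE z in circle. \<phi> z * cnj (\<phi> z) = 1"
    using assms(2) by (eventually_elim; simp add: complex_norm_square[symmetric] mult.commute)+
  show "mult_op (\<lambda>z. cnj (\<phi> z)) (mult_op \<phi> f) = f"
    using mult_op_cong_AE[OF _ _ *(1), of f] assms(1) by (simp add: mult_op_mult Linf_intros mult_op_const)
  show "mult_op \<phi> (mult_op (\<lambda>z. cnj (\<phi> z)) f) = f"
    using mult_op_cong_AE[OF _ _ *(2), of f] assms(1) by (simp add: mult_op_mult Linf_intros mult_op_const)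
qed

lemma norm_l2_power2: "(norm f)\<^sup>2 = (\<integral>z. (norm (rep_l2_circle f z))\<^sup>2 \<partial>circle)" for f :: l2_circle
proof -
  have "AE z in circle. rep_l2_circle 0 z = 0"
    unfolding zero_l2_circle_def using rep_abs_l2_circle[OF square_integrable_zero] by simp
  then have "AE z in circle. (norm (rep_l2_circle f z - rep_l2_circle 0 z))\<^sup>2 = (norm (rep_l2_circle f z))\<^sup>2"
    by eventually_elim simp
  then have "(\<integral>z. (norm (rep_l2_circle f z - rep_l2_circle 0 z))\<^sup>2 \<partial>circle)
      = (\<integral>z. (norm (rep_l2_circle f z))\<^sup>2 \<partial>circle)"
    using square_integrable_rep[of f, THEN square_integrable_measurable]
      square_integrable_rep[of 0, THEN square_integrable_measurable]
    by (intro integral_cong_AE) (auto cong: measurable_cong_sets)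
  then show ?thesis using dist_l2_circle_power2[of f 0] by simp
qed

lemma rep_mult_op:
  "\<phi> \<in> Linf \<Longrightarrow> AE z in circle. rep_l2_circle (mult_op \<phi> f) z = \<phi> z * rep_l2_circle f z"
  using rep_abs_l2_circle[OF square_integrable_mult_Linf[OF _ square_integrable_rep]]
  by (simp add: mult_op_def map_fun_def)

text \<open>The absolute value saves arguing that an essential bound \<open>C\<close> is
  nonnegative.\<close>

lemma norm_mult_op_le:
  assumes "\<phi> \<in> Linf" "AE z in circle. norm (\<phi> z) \<le> C"
  shows "norm (mult_op \<phi> f) \<le> \<bar>C\<bar> * norm f"
proof -
  have [measurable]: "rep_l2_circle g \<in> borel_measurable circle" for g
    using square_integrable_rep by (rule square_integrable_measurable)
  have i: "integrable circle (\<lambda>z. (norm (rep_l2_circle g z))\<^sup>2)" for g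
    using square_integrable_rep[of g] by (simp add: square_integrable_def)
  have "(norm (mult_op \<phi> f))\<^sup>2 \<le> (\<integral>z. C\<^sup>2 * (norm (rep_l2_circle f z))\<^sup>2 \<partial>circle)"
    unfolding norm_l2_power2
  proof (rule integral_mono_AE[OF i])
    show "integrable circle (\<lambda>z. C\<^sup>2 * (norm (rep_l2_circle f z))\<^sup>2)" using i by simp
    show "AE z in circle. (norm (rep_l2_circle (mult_op \<phi> f) z))\<^sup>2 \<le> C\<^sup>2 * (norm (rep_l2_circle f z))\<^sup>2"
      using rep_mult_op[OF assms(1), of f] assms(2)
      by eventually_elim (auto simp: norm_mult power_mult_distrib intro!: mult_right_mono power_mono)
  qed
  also have "\<dots> = (\<bar>C\<bar> * norm f)\<^sup>2" by (simp add: norm_l2_power2 power_mult_distrib)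
  finally show ?thesis by (rule power2_le_imp_le) simp
qed

text \<open>Bounded functions become multiplication operators applied to the constant 1, so that the
  calculus of symbols yields the calculus of their classes.\<close>

lemma L2_class_eq_mult_op: "\<phi> \<in> Linf \<Longrightarrow> L2_class \<phi> = mult_op \<phi> (L2_class (\<lambda>_. 1))"
  by transfer (auto simp: L2_rel_def square_integrable_Linf const_Linf)

lemma mult_op_L2_class:
  "\<phi> \<in> Linf \<Longrightarrow> \<psi> \<in> Linf \<Longrightarrow> mult_op \<phi> (L2_class \<psi>) = L2_class (\<lambda>z. \<phi> z * \<psi> z)"
  by (simp add: L2_class_eq_mult_op mult_op_mult Linf_mult)

lemma L2_class_diff:
  "\<phi> \<in> Linf \<Longrightarrow> \<psi> \<in> Linf \<Longrightarrow> L2_class (\<lambda>z. \<phi> z - \<psi> z) = L2_class \<phi> - L2_class \<psi>"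
  by (simp add: L2_class_eq_mult_op mult_op_symbol_diff Linf_diff)

lemma L2_class_scale: "\<phi> \<in> Linf \<Longrightarrow> L2_class (\<lambda>z. c * \<phi> z) = c *\<^sub>C L2_class \<phi>"
  by (simp add: mult_op_L2_class[OF const_Linf, symmetric] mult_op_const)

lemma L2_class_const: "L2_class (\<lambda>_. c) = c *\<^sub>C L2_class (\<lambda>_. 1)"
  using L2_class_scale[OF const_Linf[of 1], of c] by simp

lemma L2_class_cong_AE:
  "\<phi> \<in> Linf \<Longrightarrow> \<psi> \<in> Linf \<Longrightarrow> AE z in circle. \<phi> z = \<psi> z \<Longrightarrow> L2_class \<phi> = L2_class \<psi>"
  by (metis L2_class_eq_mult_op mult_op_cong_AE)

lemma L2_cnj_add: "L2_cnj (f + g) = L2_cnj f + L2_cnj g"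
  by transfer (auto simp: L2_rel_def intro: square_integrable_add square_integrable_cnj)

lemma L2_cnj_scaleC: "L2_cnj (a *\<^sub>C f) = cnj a *\<^sub>C L2_cnj f"
  by transfer (auto simp: L2_rel_def intro: square_integrable_scale square_integrable_cnj)

lemma L2_cnj_diff: "L2_cnj (f - g) = L2_cnj f - L2_cnj g"
  using L2_cnj_add[of f "(-1) *\<^sub>C g"] L2_cnj_scaleC[of "-1" g] by (simp add: scaleC_minus1)

lemma L2_cnj_L2_cnj [simp]: "L2_cnj (L2_cnj f) = f"
  by transfer (auto simp: L2_rel_def)

lemma cinner_L2_cnj: "cinner (L2_cnj f) (L2_cnj g) = cnj (cinner f g)"
  by transfer (simp flip: Bochner_Integration.integral_cnj)

lemma L2_cnj_mult_op: "\<phi> \<in> Linf \<Longrightarrow> L2_cnj (mult_op \<phi> f) = mult_op (\<lambda>z. cnj (\<phi> z)) (L2_cnj f)"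
  by transfer (auto simp: L2_rel_def Linf_cnj intro: square_integrable_mult_Linf square_integrable_cnj)

lemma L2_cnj_L2_class: "\<phi> \<in> Linf \<Longrightarrow> L2_cnj (L2_class \<phi>) = L2_class (\<lambda>z. cnj (\<phi> z))"
  by transfer (auto simp: L2_rel_def square_integrable_Linf intro: square_integrable_cnj)

section \<open>Exponentials and the completeness of the Fourier system\<close>

definition powi_class :: "int \<Rightarrow> l2_circle"
  where "powi_class n = L2_class (\<lambda>z. z powi n)"

lemma fourier_coeff_eq: "fourier_coeff f n = cinner f (powi_class n)"
  by (simp add: fourier_coeff_def powi_class_def)

lemma L2_class_one: "L2_class (\<lambda>_. 1) = powi_class 0"
  by (simp add: powi_class_def)

text \<open>The measure is carried by the whole plane, and at 0 the exponent law for
  \<open>powi\<close> fails, for instance for the exponents 1 and -1. Identities between powers are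
  therefore only claimed almost everywhere.\<close>

lemma AE_circle_nonzero: "AE z in circle. z \<noteq> 0"
  using AE_circle_norm by eventually_elim auto

lemma mult_powi_class: "mult_op (\<lambda>z. z powi m) (powi_class n) = powi_class (m + n)"
proof -
  have "AE z in circle. z powi m * z powi n = z powi (m + n)"
    using AE_circle_nonzero by eventually_elim (simp add: power_int_add)
  then show ?thesis
    by (simp add: powi_class_def mult_op_L2_class Linf_intros L2_class_cong_AE)
qed

lemma cnj_powi_AE: "AE z in circle. cnj (z powi n) = z powi (- n)"
  using AE_circle_norm
proof eventually_elim
  case (elim z)
  then have "cnj z = inverse z" by (simp add: inverse_eq_divide complex_div_cnj[of 1])
  then show ?case by (simp add: power_int_minus power_int_inverse)
qed

lemma cinner_mult_powi:
  "cinner (mult_op (\<lambda>z. z powi m) f) g = cinner f (mult_op (\<lambda>z. z powi (- m)) g)"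
  using mult_op_cong_AE[OF _ _ cnj_powi_AE[of m], of g]
  by (simp add: cinner_mult_op Linf_cnj powi_Linf del: complex_cnj_power_int)

lemma fourier_coeff_mult_powi: "fourier_coeff (mult_op (\<lambda>z. z powi m) f) n = fourier_coeff f (n - m)"
  by (simp add: fourier_coeff_eq cinner_mult_powi mult_powi_class)

lemma L2_cnj_powi_class: "L2_cnj (powi_class n) = powi_class (- n)"
  unfolding powi_class_def
  by (simp add: L2_cnj_L2_class Linf_cnj powi_Linf L2_class_cong_AE[OF _ _ cnj_powi_AE]
      del: complex_cnj_power_int)

lemma fourier_coeff_L2_cnj: "fourier_coeff (L2_cnj f) n = cnj (fourier_coeff f (- n))"
  using cinner_L2_cnj[of f "powi_class (- n)"] by (simp add: fourier_coeff_eq L2_cnj_powi_class)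

lemma mult_op_powi_mult: "mult_op (\<lambda>z. z powi m) (mult_op (\<lambda>z. z powi n) f) = mult_op (\<lambda>z. z powi (m + n)) f"
proof -
  have "AE z in circle. z powi m * z powi n = z powi (m + n)"
    using AE_circle_nonzero by eventually_elim (simp add: power_int_add)
  then show ?thesis by (simp add: mult_op_mult Linf_intros mult_op_cong_AE)
qed

lemma cinner_powi_class_self: "cinner (powi_class m) (powi_class m) = 1"
proof -
  interpret finite_measure circle by (rule finite_measure_circle)
  have "cinner (powi_class m) (powi_class m) = cinner (powi_class 0) (powi_class 0)"
    using cinner_mult_powi[of m "powi_class 0" "powi_class m"] by (simp add: mult_powi_class)
  also have "\<dots> = (\<integral>z. 1 * cnj 1 \<partial>circle)"
    unfolding powi_class_def
    by (simp add: L2_class.abs_eq cinner_l2_circle.abs_eq L2_rel_def square_integrable_Linf const_Linf)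
  also have "\<dots> = 1" by (simp add: measure_def)
  finally show ?thesis .
qed

text \<open>A continuous function on the plane may be unbounded, but compactness bounds it on the
  unit circle, which has full measure.\<close>

lemma Linf_continuous:
  assumes "continuous_on UNIV \<phi>"
  shows "\<phi> \<in> Linf"
proof -
  have "compact (\<phi> ` sphere 0 1)"
    using assms by (intro compact_continuous_image) (auto intro: continuous_on_subset)
  then obtain C where "\<And>z. z \<in> sphere 0 1 \<Longrightarrow> norm (\<phi> z) \<le> C"
    using compact_imp_bounded bounded_iff by (metis imageI)
  then have "AE z in circle. norm (\<phi> z) \<le> C"
    using AE_circle_norm by (auto elim!: eventually_mono)
  then show ?thesis using assms by (intro LinfI[OF borel_measurable_continuous_onI])
qed

text \<open>On the circle a real linear form is \<open>a * z + cnj a / z\<close>, so its multiplication only shifts and combines coefficients.\<close>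

lemma fourier_coeff_mult_polynomial:
  assumes "real_polynomial_function p" "\<And>n. fourier_coeff f n = 0"
  shows "fourier_coeff (mult_op (\<lambda>z. complex_of_real (p z)) f) n = 0"
  using assms
proof (induction p arbitrary: f n rule: real_polynomial_function.induct)
  case (linear p)
  define a where "a = (complex_of_real (p 1) - \<i> * complex_of_real (p \<i>)) / 2"
  have p: "complex_of_real (p z) = a * z powi 1 + cnj a * cnj (z powi 1)" for z
  proof -
    have "p z = p (Re z *\<^sub>R 1 + Im z *\<^sub>R \<i>)"
      by (rule arg_cong[of _ _ p]) (simp add: complex_eq_iff)
    also have "\<dots> = Re z * p 1 + Im z * p \<i>"
      using linear by (simp add: bounded_linear.linear linear_add linear_scale)
    finally show ?thesis by (simp add: a_def complex_eq_iff field_simps)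
  qed
  have "AE z in circle. complex_of_real (p z) = a * z powi 1 + cnj a * z powi (- 1)"
    unfolding p using cnj_powi_AE[of 1] by eventually_elim simp
  moreover have "(\<lambda>z. complex_of_real (p z)) \<in> Linf" unfolding p by (intro Linf_intros)
  ultimately have "mult_op (\<lambda>z. complex_of_real (p z)) f = mult_op (\<lambda>z. a * z powi 1 + cnj a * z powi (- 1)) f"
    by (intro mult_op_cong_AE Linf_intros)
  also have "\<dots> = a *\<^sub>C mult_op (\<lambda>z. z powi 1) f + cnj a *\<^sub>C mult_op (\<lambda>z. z powi (- 1)) f"
    by (simp only: mult_op_symbol_add mult_op_symbol_scale Linf_intros)
  finally show ?case
    using fourier_coeff_mult_powi[of 1 f n] fourier_coeff_mult_powi[of "-1" f n] linear(2)
    by (simp add: fourier_coeff_eq cinner_simps del: power_int_1_right)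
next
  case (const c)
  then show ?case by (simp add: mult_op_const fourier_coeff_eq cinner_simps)
next
  case (add p q)
  then have "(\<lambda>z. complex_of_real (p z)) \<in> Linf" "(\<lambda>z. complex_of_real (q z)) \<in> Linf"
    by (simp_all add: Linf_continuous continuous_on_polymonial_function continuous_on_of_real
        real_polynomial_function_eq)
  then have "mult_op (\<lambda>z. complex_of_real (p z + q z)) f
      = mult_op (\<lambda>z. complex_of_real (p z)) f + mult_op (\<lambda>z. complex_of_real (q z)) f"
    by (simp add: mult_op_symbol_add)
  then show ?case using add by (simp add: fourier_coeff_eq cinner_simps)
next
  \<comment> \<open>A product acts as two successive multiplications. The inner one again gives a
    function with vanishing coefficients, which is why \<open>f\<close> is generalised in the
    induction.\<close>
  case (mult p q)
  then have "(\<lambda>z. complex_of_real (p z)) \<in> Linf" "(\<lambda>z. complex_of_real (q z)) \<in> Linf"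
    by (simp_all add: Linf_continuous continuous_on_polymonial_function continuous_on_of_real
        real_polynomial_function_eq)
  then have "mult_op (\<lambda>z. complex_of_real (p z * q z)) f
      = mult_op (\<lambda>z. complex_of_real (p z)) (mult_op (\<lambda>z. complex_of_real (q z)) f)"
    by (simp add: mult_op_mult)
  then show ?case using mult by metis
qed

text \<open>Polynomials in Re z and Im z approximate \<open>g\<close> uniformly on the circle, and
  replacing \<open>g\<close> by one within \<open>e\<close> costs at most \<open>e\<close> times a
  fixed product of norms.\<close>

lemma cinner_mult_continuous_eq_0:
  fixes g :: "complex \<Rightarrow> real"
  assumes "\<And>n. fourier_coeff f n = 0" "continuous_on UNIV g"
  shows "cinner (mult_op (\<lambda>z. complex_of_real (g z)) f) (powi_class 0) = 0"
proof -
  have L: "(\<lambda>z. complex_of_real (h z)) \<in> Linf" if "continuous_on UNIV h" for h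
    using that by (intro Linf_continuous continuous_intros)
  have "cmod (cinner (mult_op (\<lambda>z. complex_of_real (g z)) f) (powi_class 0)) \<le> 0 + e * (norm f * norm (powi_class 0))"
    if e: "0 < e" for e
  proof -
    obtain p where p: "real_polynomial_function p" "\<And>z. z \<in> sphere 0 1 \<Longrightarrow> \<bar>g z - p z\<bar> < e"
      using Stone_Weierstrass_real_polynomial_function[of "sphere (0::complex) 1" g e] assms(2) e
      by (metis compact_sphere continuous_on_subset subset_UNIV)
    have cp: "continuous_on UNIV p"
      using p(1) by (simp add: continuous_on_polymonial_function real_polynomial_function_eq)
    have "cinner (mult_op (\<lambda>z. complex_of_real (p z)) f) (powi_class 0) = 0"
      using fourier_coeff_mult_polynomial[OF p(1) assms(1), of 0] by (simp add: fourier_coeff_eq)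
    then have "cinner (mult_op (\<lambda>z. complex_of_real (g z)) f) (powi_class 0)
        = cinner (mult_op (\<lambda>z. complex_of_real (g z) - complex_of_real (p z)) f) (powi_class 0)"
      by (simp only: mult_op_symbol_diff[OF L[OF assms(2)] L[OF cp]] cinner_diff_left) simp
    also have "cmod \<dots> \<le> norm (mult_op (\<lambda>z. complex_of_real (g z) - complex_of_real (p z)) f) * norm (powi_class 0)"
      by (rule cmod_cinner_le)
    also have "\<dots> \<le> (\<bar>e\<bar> * norm f) * norm (powi_class 0)"
    proof (intro mult_right_mono norm_mult_op_le Linf_diff L assms cp)
      have "norm (complex_of_real (g z) - complex_of_real (p z)) \<le> e" if "norm z = 1" for z
        using p(2)[of z] that by (simp flip: of_real_diff)
      then show "AE z in circle. norm (complex_of_real (g z) - complex_of_real (p z)) \<le> e"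
        using AE_circle_norm by (auto elim!: eventually_mono)
    qed simp
    finally show ?thesis using e by (simp add: mult.assoc)
  qed
  note bound = this
  have "cmod (cinner (mult_op (\<lambda>z. complex_of_real (g z)) f) (powi_class 0)) \<le> 0"
  proof (rule field_le_epsilon)
    fix e :: real assume e: "0 < e"
    define B where "B = norm f * norm (powi_class 0)"
    have B: "0 \<le> B" by (simp add: B_def)
    \<comment> \<open>\<open>B\<close> may be 0, hence the divisor \<open>B + 1\<close>.\<close>
    have "cmod (cinner (mult_op (\<lambda>z. complex_of_real (g z)) f) (powi_class 0)) \<le> 0 + e / (B + 1) * B"
      unfolding B_def using e by (intro bound[unfolded B_def]) (simp add: add_nonneg_pos)
    also have "\<dots> \<le> 0 + e" using e B by (simp add: field_simps)
    finally show "cmod (cinner (mult_op (\<lambda>z. complex_of_real (g z)) f) (powi_class 0)) \<le> 0 + e" .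
  qed
  then show ?thesis by simp
qed

lemma cinner_mult_powi_class_0:
  assumes "\<phi> \<in> Linf"
  shows "cinner (mult_op \<phi> f) (powi_class 0) = (\<integral>z. \<phi> z * rep_l2_circle f z \<partial>circle)"
proof -
  have "cinner (abs_l2_circle (\<lambda>z. \<phi> z * rep_l2_circle f z)) (powi_class 0) = (\<integral>z. \<phi> z * rep_l2_circle f z \<partial>circle)"
    unfolding powi_class_def using assms
    by (simp add: L2_class.abs_eq cinner_l2_circle.abs_eq L2_rel_def square_integrable_Linf const_Linf
        square_integrable_mult_Linf square_integrable_rep)
  then show ?thesis using assms by (simp add: mult_op_def map_fun_def)
qed

text \<open>Vanishing coefficients make the integral of \<open>F\<close> against every continuous
  function vanish. Passing from continuous functions to indicators of closed sets, and from those to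
  all Borel sets, leaves a function with zero integral over every set, hence zero almost
  everywhere.\<close>

theorem fourier_coeff_unique:
  assumes "\<And>n. fourier_coeff f n = 0"
  shows "f = 0"
proof -
  interpret finite_measure circle by (rule finite_measure_circle)
  define F where "F = rep_l2_circle f"
  have F: "integrable circle F"
    using integrable_mult_cnj[OF square_integrable_rep[of f] square_integrable_Linf[OF const_Linf[of 1]]]
    by (simp add: F_def)
  then have Fm [measurable]: "F \<in> borel_measurable borel"
    by (auto cong: measurable_cong_sets)
  have si: "set_integrable circle A F" if "A \<in> sets circle" for A
    unfolding set_integrable_def using F that by (rule integrable_mult_indicator[rotated])
  have cont: "(\<integral>z. complex_of_real (g z) * F z \<partial>circle) = 0" if "continuous_on UNIV g" for g :: "complex \<Rightarrow> real"
    using cinner_mult_powi_class_0[of "\<lambda>z. complex_of_real (g z)" f] cinner_mult_continuous_eq_0[OF assms that]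
      that by (simp add: F_def Linf_continuous continuous_intros)
  have closed: "(LINT z:C|circle. F z) = 0" if C: "closed C" for C
  \<comment> \<open>The empty set is separated because \<open>infdist\<close> to it is 0 by
    convention, which would make the cutoffs below constantly 1.\<close>
  proof (cases "C = {}")
    case False
    have [measurable]: "C \<in> sets borel" using C by (rule borel_closed)
    \<comment> \<open>Continuous cutoffs that equal 1 on \<open>C\<close> and are eventually 0 at
      each point outside it, as points off a closed set have positive distance to it.\<close>
    define g where "g n z = max 0 (1 - real n * infdist z C)" for n z
    have "(\<lambda>n. \<integral>z. complex_of_real (g n z) * F z \<partial>circle) \<longlonglongrightarrow> (\<integral>z. indicator C z *\<^sub>R F z \<partial>circle)"
    proof (rule integral_dominated_convergence)
      show "(\<lambda>z. indicator C z *\<^sub>R F z) \<in> borel_measurable circle" by measurable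
      show "(\<lambda>z. complex_of_real (g n z) * F z) \<in> borel_measurable circle" for n
      proof -
        have [measurable]: "g n \<in> borel_measurable borel"
          unfolding g_def by (intro borel_measurable_continuous_onI continuous_intros)
        show ?thesis by measurable
      qed
      show "integrable circle (\<lambda>z. norm (F z))" using F by simp
      show "AE z in circle. norm (complex_of_real (g n z) * F z) \<le> norm (F z)" for n
        by (auto simp: norm_mult g_def infdist_nonneg intro!: mult_left_le_one_le)
      have "(\<lambda>n. complex_of_real (g n z) * F z) \<longlonglongrightarrow> indicator C z *\<^sub>R F z" for z
      proof (cases "z \<in> C")
        case True
        then show ?thesis by (simp add: g_def)
      next
        case out: False
        then have pos: "infdist z C > 0"
          using C False by (simp add: infdist_pos_not_in_closed)
        have "\<forall>\<^sub>F n in sequentially. complex_of_real (g n z) * F z = 0"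
          using eventually_ge_at_top[of "nat \<lceil>1 / infdist z C\<rceil>"]
        proof eventually_elim
          case (elim n)
          then have "1 / infdist z C \<le> real n" by linarith
          then show ?case using pos by (simp add: g_def field_simps)
        qed
        then show ?thesis using out by (simp add: tendsto_eventually)
      qed
      then show "AE z in circle. (\<lambda>n. complex_of_real (g n z) * F z) \<longlonglongrightarrow> indicator C z *\<^sub>R F z" by simp
    qed
    moreover have "(\<integral>z. complex_of_real (g n z) * F z \<partial>circle) = 0" for n
      unfolding g_def by (intro cont continuous_intros)
    ultimately show ?thesis
      by (simp add: set_lebesgue_integral_def LIMSEQ_const_iff)
  qed (simp add: set_lebesgue_integral_def)
  have total: "(\<integral>z. F z \<partial>circle) = 0"
    using closed[of UNIV] by (simp add: set_lebesgue_integral_def)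
  have "(LINT z:A|circle. F z) = 0" if "A \<in> sets circle" for A
  proof -
    have b: "sigma_sets UNIV (Collect closed) = sets (circle)" by (simp add: borel_eq_closed)
    have "A \<in> sigma_sets UNIV (Collect closed)" using that b by simp
    \<comment> \<open>Closed sets form an intersection-stable generator of the Borel sets, so it
      remains to close the vanishing of the integral under complements and countable disjoint
      unions.\<close>
    have "Int_stable (Collect closed :: complex set set)" "Collect closed \<subseteq> Pow (UNIV :: complex set)"
      by (auto simp: Int_stable_def)
    from this \<open>A \<in> sigma_sets UNIV (Collect closed)\<close> show ?thesis
    proof (induction rule: sigma_sets_induct_disjoint)
      case (compl A)
      then have "A \<in> sets circle" using b by simp
      have "(LINT z:UNIV - A|circle. F z) + (LINT z:A|circle. F z) = (LINT z:(UNIV - A) \<union> A|circle. F z)"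
        using \<open>A \<in> sets circle\<close> by (intro set_integral_Un[symmetric] si) auto
      then show ?case using compl total by (simp add: set_lebesgue_integral_def)
    next
      case (union A)
      then have "range A \<subseteq> sets circle" using b by simp
      then have "(LINT z:(\<Union>i. A i)|circle. F z) = (\<Sum>i. (LINT z:(A i)|circle. F z))"
        using union(1) by (intro lebesgue_integral_countable_add si) (auto simp: disjoint_family_on_def)
      then show ?case using union by simp
    qed (auto simp: closed[unfolded set_lebesgue_integral_def] set_lebesgue_integral_def)
  qed
  then have "AE z in circle. F z = 0" by (intro density_zero[OF F])
  then have "AE z in circle. (norm (F z))\<^sup>2 = 0" by eventually_elim simp
  then have "(\<integral>z. (norm (F z))\<^sup>2 \<partial>circle) = 0" by (rule integral_eq_zero_AE)
  then have "(norm f)\<^sup>2 = 0" by (simp only: norm_l2_power2 F_def)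
  then show ?thesis by simp
qed

section \<open>Hardy space, model space and the compressed shift\<close>

lemma integral_cis_eq_0:
  assumes "k \<noteq> 0"
  shows "(\<integral>t. cis (real_of_int k * t) \<partial>uniform_measure lborel {0..2*pi}) = 0"
proof -
  define F where "F t = cis (real_of_int k * t) / (\<i> * of_int k)" for t
  have "(LBINT t. indicator {0..2*pi} t *\<^sub>R cis (real_of_int k * t)) = F (2*pi) - F 0"
  proof (rule integral_FTC_atLeastAtMost)
    show "(F has_vector_derivative cis (real_of_int k * t)) (at t within {0..2*pi})" for t
      unfolding F_def has_vector_derivative_def using assms
      by (auto intro!: derivative_eq_intros simp: scaleR_conv_of_real field_simps)
    show "continuous_on {0..2*pi} (\<lambda>t. cis (real_of_int k * t))"
      by (intro continuous_intros)
  qed simp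
  also have "\<dots> = 0"
    using cis_multiple_2pi[of "real_of_int k"] by (simp add: F_def mult.left_commute mult.commute)
  finally have *: "(LBINT t. indicator {0..2*pi} t *\<^sub>R cis (real_of_int k * t)) = 0" .
  have "uniform_measure lborel {0..2*pi} = density lborel (\<lambda>t. ennreal (indicator {0..2*pi} t / (2*pi)))"
    unfolding uniform_measure_def
    by (intro density_cong) (auto simp: divide_ennreal[symmetric] split: split_indicator)
  then have "(\<integral>t. cis (real_of_int k * t) \<partial>uniform_measure lborel {0..2*pi})
      = (LBINT t. (indicator {0..2*pi} t / (2*pi)) *\<^sub>R cis (real_of_int k * t))"
    by (simp only:) (intro integral_density; auto intro!: borel_measurable_continuous_onI continuous_intros)
  also have "\<dots> = (LBINT t. (1 / (2*pi)) *\<^sub>R (indicator {0..2*pi} t *\<^sub>R cis (real_of_int k * t)))"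
    by (intro Bochner_Integration.integral_cong) auto
  also have "\<dots> = 0" by (simp only: Bochner_Integration.integral_scaleR_right *) simp
  finally show ?thesis .
qed

lemma cinner_powi_class: "cinner (powi_class m) (powi_class n) = (if m = n then 1 else 0)"
proof (cases "m = n")
  case False
  have "cinner (powi_class m) (powi_class n) = cinner (powi_class (m - n)) (powi_class 0)"
    using cinner_mult_powi[of n "powi_class (m - n)" "powi_class n"] by (simp add: mult_powi_class)
  also have "\<dots> = (\<integral>z. z powi (m - n) \<partial>circle)"
    unfolding powi_class_def
    by (simp add: L2_class.abs_eq cinner_l2_circle.abs_eq L2_rel_def square_integrable_Linf const_Linf powi_Linf)
  also have "\<dots> = (\<integral>t. (cis t) powi (m - n) \<partial>uniform_measure lborel {0..2*pi})"
    unfolding circle_def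
    by (rule integral_distr) (use LinfD[OF powi_Linf] in auto)
  also have "\<dots> = (\<integral>t. cis (real_of_int (m - n) * t) \<partial>uniform_measure lborel {0..2*pi})"
    by (intro Bochner_Integration.integral_cong) (auto simp: cis_power_int)
  also have "\<dots> = 0" using False by (intro integral_cis_eq_0) simp
  finally show ?thesis using False by simp
qed (simp add: cinner_powi_class_self)

section \<open>The Hardy space and its bounded multipliers\<close>

lemma hardy_space_eq: "hardy_space = orth_compl (powi_class ` {..<0})"
  by (auto simp: hardy_space_def orth_compl_def fourier_coeff_eq)

lemma csubspace_hardy: "csubspace hardy_space"
  and closed_hardy: "closed hardy_space"
  by (simp_all add: hardy_space_eq csubspace_orth_compl closed_orth_compl)

lemma hardy_memI: "(\<And>n. n < 0 \<Longrightarrow> fourier_coeff f n = 0) \<Longrightarrow> f \<in> hardy_space"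
  by (simp add: hardy_space_def)

lemma powi_class_hardy: "0 \<le> n \<Longrightarrow> powi_class n \<in> hardy_space"
  by (auto simp: hardy_space_def fourier_coeff_eq cinner_powi_class)

lemma mult_powi_hardy: "0 \<le> n \<Longrightarrow> f \<in> hardy_space \<Longrightarrow> mult_op (\<lambda>z. z powi n) f \<in> hardy_space"
  by (auto simp: hardy_space_def fourier_coeff_mult_powi)

text \<open>The projection of such an \<open>f\<close> onto the Hardy space has no nonzero Fourier coefficient.\<close>

lemma cinner_anti_hardy:
  assumes "\<And>n. 0 \<le> n \<Longrightarrow> fourier_coeff f n = 0" "h \<in> hardy_space"
  shows "cinner f h = 0"
proof -
  note H = closed_hardy csubspace_hardy
  define p where "p = orth_proj hardy_space f"
  have "fourier_coeff p n = 0" for n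
  proof (cases "n < 0")
    case True
    then show ?thesis using orth_proj_props(1)[OF H] by (simp add: p_def hardy_space_def)
  next
    case False
    then show ?thesis
      using orth_proj_props(2)[OF H powi_class_hardy, of n f] assms(1)[of n]
      by (simp add: p_def fourier_coeff_eq)
  qed
  then have "p = 0" by (rule fourier_coeff_unique)
  then show ?thesis using orth_proj_props(2)[OF H assms(2), of f] by (simp add: p_def)
qed

lemma mult_op_commute: "\<phi> \<in> Linf \<Longrightarrow> \<psi> \<in> Linf \<Longrightarrow> mult_op \<phi> (mult_op \<psi> f) = mult_op \<psi> (mult_op \<phi> f)"
  by (simp add: mult_op_mult mult.commute)

lemma L2_class_eq_mult_powi: "\<phi> \<in> Linf \<Longrightarrow> L2_class \<phi> = mult_op \<phi> (powi_class 0)"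
  by (simp add: L2_class_eq_mult_op L2_class_one)

lemma cinner_mult_op': "\<phi> \<in> Linf \<Longrightarrow> cinner (mult_op (\<lambda>z. cnj (\<phi> z)) f) g = cinner f (mult_op \<phi> g)"
  using cinner_mult_op[OF Linf_cnj, of \<phi> f g] by simp

text \<open>Multiplication is moved to the other side of the inner product: for \<open>n < 0\<close>
  the function cnj \<phi> z^n has no coefficient of index \<ge> 0, because its coefficient at
  \<open>m\<close> is the conjugate of the coefficient of \<phi> at \<open>n - m\<close>. It is
  therefore orthogonal to \<open>h\<close>.\<close>

lemma mult_op_hardy:
  assumes \<phi>: "\<phi> \<in> Linf" "L2_class \<phi> \<in> hardy_space" and h: "h \<in> hardy_space"
  shows "mult_op \<phi> h \<in> hardy_space"
proof (rule hardy_memI)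
  fix n :: int assume n: "n < 0"
  have "cinner (mult_op (\<lambda>z. cnj (\<phi> z)) (powi_class n)) h = 0"
  proof (rule cinner_anti_hardy[OF _ h])
    fix m :: int assume m: "0 \<le> m"
    have "mult_op \<phi> (powi_class m) = mult_op (\<lambda>z. z powi m) (L2_class \<phi>)"
      using mult_op_commute[OF \<phi>(1) powi_Linf, of m "powi_class 0"] 
      by (simp add: L2_class_eq_mult_powi \<phi> mult_powi_class)
    then have "fourier_coeff (mult_op (\<lambda>z. cnj (\<phi> z)) (powi_class n)) m
        = cnj (fourier_coeff (mult_op (\<lambda>z. z powi m) (L2_class \<phi>)) n)"
      by (simp add: fourier_coeff_eq cinner_mult_op' \<phi> cinner_commute[of "powi_class n"])
    also have "\<dots> = 0" using \<phi>(2) m n by (simp add: fourier_coeff_mult_powi hardy_space_def)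
    finally show "fourier_coeff (mult_op (\<lambda>z. cnj (\<phi> z)) (powi_class n)) m = 0" .
  qed
  then show "fourier_coeff (mult_op \<phi> h) n = 0"
    using \<phi>(1) by (simp add: fourier_coeff_eq cinner_mult_op cinner_commute[of h])
qed

section \<open>The model space and its bounded elements\<close>

locale inner_symbol =
  fixes u :: "complex \<Rightarrow> complex"
  assumes inner_u: "inner_function u"
begin

abbreviation K where "K \<equiv> model_space u"
abbreviation A where "A \<equiv> truncated_toeplitz u"
abbreviation S where "S \<equiv> truncated_toeplitz u (\<lambda>z. z)"

lemma u_Linf: "u \<in> Linf" and u_hardy: "L2_class u \<in> hardy_space"
  and u_unimodular: "AE z in circle. norm (u z) = 1"
  using inner_u by (auto simp: inner_function_def)

lemma mult_u_hardy: "h \<in> hardy_space \<Longrightarrow> mult_op u h \<in> hardy_space"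
  by (rule mult_op_hardy[OF u_Linf u_hardy])

lemma cinner_mult_u: "cinner (mult_op u f) (mult_op u g) = cinner f g"
  by (simp add: cinner_mult_op u_Linf mult_op_unimodular[OF u_Linf u_unimodular])

lemma model_eq: "K = orth_compl (powi_class ` {..<0} \<union> mult_op u ` hardy_space)"
  by (auto simp: model_space_def hardy_space_eq orth_compl_def)

lemma csubspace_model: "csubspace K" and closed_model: "closed K"
  by (simp_all add: model_eq csubspace_orth_compl closed_orth_compl)

lemmas model_simps = csubspace_0[OF csubspace_model] csubspace_add[OF csubspace_model]
  csubspace_diff[OF csubspace_model] csubspace_scaleC[OF csubspace_model]

lemmas proj_props = orth_proj_props[OF closed_model csubspace_model]

lemma model_hardy: "f \<in> K \<Longrightarrow> f \<in> hardy_space"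
  and model_orth: "f \<in> K \<Longrightarrow> h \<in> hardy_space \<Longrightarrow> cinner f (mult_op u h) = 0"
  and model_memI: "f \<in> hardy_space \<Longrightarrow> (\<And>h. h \<in> hardy_space \<Longrightarrow> cinner f (mult_op u h) = 0) \<Longrightarrow> f \<in> K"
  by (auto simp: model_space_def)

lemma model_orth': "f \<in> K \<Longrightarrow> h \<in> hardy_space \<Longrightarrow> cinner (mult_op u h) f = 0"
  by (subst cinner_commute) (simp add: model_orth)

text \<open>The decomposition of H^2 into K and u H^2. With \<open>p\<close> the Hardy projection of
  cnj u f, the remainder f - u p lies in H^2 and is orthogonal to u H^2, hence lies in K;
  orthogonality of \<open>f\<close> to K then kills it.\<close>

lemma orth_model_imp_mult_u:
  assumes f: "f \<in> hardy_space" and orth: "\<And>k. k \<in> K \<Longrightarrow> cinner f k = 0"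
  shows "\<exists>h\<in>hardy_space. f = mult_op u h"
proof -
  note H = closed_hardy csubspace_hardy
  define g where "g = mult_op (\<lambda>z. cnj (u z)) f"
  define p where "p = orth_proj hardy_space g"
  have p: "p \<in> hardy_space" using orth_proj_props(1)[OF H] by (simp add: p_def)
  have gp: "cinner (g - p) h = 0" if "h \<in> hardy_space" for h
    using orth_proj_props(2)[OF H that, of g] by (simp add: p_def cinner_simps)
  have f_eq: "f = mult_op u p + mult_op u (g - p)"
    by (simp add: mult_op_diff g_def mult_op_unimodular[OF u_Linf u_unimodular])
  have "f - mult_op u p \<in> hardy_space"
    using f mult_u_hardy[OF p] by (rule csubspace_diff[OF csubspace_hardy])
  then have "mult_op u (g - p) \<in> hardy_space" using f_eq by simp
  then have K: "mult_op u (g - p) \<in> K"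
    by (rule model_memI) (simp add: cinner_mult_u gp)
  have "cinner (mult_op u p) (mult_op u (g - p)) = 0" by (rule model_orth'[OF K p])
  moreover have "cinner (mult_op u p + mult_op u (g - p)) (mult_op u (g - p)) = 0"
    using orth[OF K] f_eq by simp
  ultimately have "mult_op u (g - p) = 0" by (simp add: cinner_add_left)
  then show ?thesis using f_eq p by auto
qed

text \<open>The orthogonality says that cnj u x has no negative coefficients. Hence x lies in u H^2
  as well as in K, and is orthogonal to itself.\<close>

lemma model_total:
  assumes x: "x \<in> K" and orth: "\<And>n. n < 0 \<Longrightarrow> cinner x (mult_op u (powi_class n)) = 0"
  shows "x = 0"
proof -
  define y where "y = mult_op (\<lambda>z. cnj (u z)) x"
  have xy: "x = mult_op u y" by (simp add: y_def mult_op_unimodular[OF u_Linf u_unimodular])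
  have "y \<in> hardy_space"
    by (rule hardy_memI) (simp add: fourier_coeff_eq y_def cinner_mult_op' u_Linf orth)
  then have "cinner x x = 0" using model_orth[OF x] xy by metis
  then show ?thesis by simp
qed

text \<open>The witnesses are the iterated backward shifts of \<open>u\<close>: each differs from \<open>z powi (- n) * u\<close> by a trigonometric polynomial.\<close>

lemma bounded_shift:
  "\<exists>F\<in>Linf. L2_class F \<in> hardy_space \<and>
    (\<forall>x\<in>hardy_space. cinner x (L2_class F) = cinner x (mult_op u (powi_class (- int n))))"
proof (induction n)
  case 0
  show ?case using u_Linf u_hardy by (intro bexI[of _ u]) (auto simp: L2_class_eq_mult_powi)
next
  case (Suc n)
  then obtain F where F: "F \<in> Linf" "L2_class F \<in> hardy_space"
    "\<And>x. x \<in> hardy_space \<Longrightarrow> cinner x (L2_class F) = cinner x (mult_op u (powi_class (- int n)))" by blast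
  define a where "a = fourier_coeff (L2_class F) 0"
  define G where "G z = z powi (- 1) * (F z - a)" for z
  have G: "G \<in> Linf" unfolding G_def by (intro Linf_intros F)
  have GF: "L2_class G = mult_op (\<lambda>z. z powi (- 1)) (L2_class F - a *\<^sub>C powi_class 0)"
    unfolding G_def mult_op_L2_class[OF powi_Linf Linf_diff[OF F(1) const_Linf], symmetric]
    by (simp only: L2_class_diff F const_Linf L2_class_const[of a] L2_class_one)
  have "L2_class G \<in> hardy_space"
  proof (rule hardy_memI)
    fix m :: int assume "m < 0"
    then have "m + 1 = 0 \<or> m + 1 < 0" by auto
    moreover have "fourier_coeff (L2_class G) m = fourier_coeff (L2_class F) (m + 1) - a * (if m + 1 = 0 then 1 else 0)"
      unfolding GF fourier_coeff_mult_powi by (simp add: fourier_coeff_eq cinner_simps cinner_powi_class)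
    ultimately show "fourier_coeff (L2_class G) m = 0"
      using F(2) by (auto simp: a_def hardy_space_def)
  qed
  moreover have "cinner x (L2_class G) = cinner x (mult_op u (powi_class (- int (Suc n))))" if x: "x \<in> hardy_space" for x
  proof -
    have zx: "mult_op (\<lambda>z. z powi 1) x \<in> hardy_space" using x by (intro mult_powi_hardy) auto
    \<comment> \<open>\<open>z x\<close> has no constant term, so subtracting the constant
      \<open>a\<close> from \<open>F\<close> does not affect the pairing.\<close>
    have "cinner (mult_op (\<lambda>z. z powi 1) x) (powi_class 0) = fourier_coeff (mult_op (\<lambda>z. z powi 1) x) 0"
      by (simp add: fourier_coeff_eq)
    also have "\<dots> = 0" using x by (simp only: fourier_coeff_mult_powi) (simp add: hardy_space_def)
    finally have "cinner x (L2_class G) = cinner (mult_op (\<lambda>z. z powi 1) x) (L2_class F)"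
      by (simp only: GF cinner_mult_powi[of 1, symmetric] cinner_diff_right cinner_scaleC_right) simp
    also have "\<dots> = cinner x (mult_op (\<lambda>z. z powi (- 1)) (mult_op u (powi_class (- int n))))"
      unfolding F(3)[OF zx] by (rule cinner_mult_powi)
    also have "mult_op (\<lambda>z. z powi (- 1)) (mult_op u (powi_class (- int n))) = mult_op u (powi_class (- int (Suc n)))"
      by (simp only: mult_op_commute[OF powi_Linf u_Linf] mult_powi_class) simp
    finally show ?thesis .
  qed
  ultimately show ?case using G by blast
qed

text \<open>The iterated backward shifts of u pair with every element of H^2 exactly as u z^n does.
  For \<open>n < 0\<close> this puts them into K, and \<open>model_total\<close> applies to
  them.\<close>

lemma bounded_total:
  assumes x: "x \<in> K" and orth: "\<And>F. F \<in> Linf \<Longrightarrow> L2_class F \<in> K \<Longrightarrow> cinner x (L2_class F) = 0"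
  shows "x = 0"
proof (rule model_total[OF x])
  fix n :: int assume n: "n < 0"
  obtain F where F: "F \<in> Linf" "L2_class F \<in> hardy_space"
    "\<And>x. x \<in> hardy_space \<Longrightarrow> cinner x (L2_class F) = cinner x (mult_op u (powi_class n))"
    using bounded_shift[of "nat (- n)"] n by auto
  have "L2_class F \<in> K"
  proof (rule model_memI[OF F(2)])
    fix h assume h: "h \<in> hardy_space"
    have "cinner (mult_op u h) (L2_class F) = fourier_coeff h n"
      by (simp add: F(3)[OF mult_u_hardy[OF h]] cinner_mult_u fourier_coeff_eq)
    then show "cinner (L2_class F) (mult_op u h) = 0"
      using h n by (subst cinner_commute) (simp add: hardy_space_def)
  qed
  then show "cinner x (mult_op u (powi_class n)) = 0"
    using orth[OF F(1)] F(3)[OF model_hardy[OF x]] by simp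
qed

section \<open>Truncated Toeplitz operators and the compressed shift\<close>

lemma tt_apply: "f \<in> K \<Longrightarrow> A \<phi> f = orth_proj K (mult_op \<phi> f)"
  by (simp add: truncated_toeplitz_def)

lemma tt_in: "f \<in> K \<Longrightarrow> A \<phi> f \<in> K"
  by (simp add: tt_apply proj_props)

lemma cinner_tt: "f \<in> K \<Longrightarrow> k \<in> K \<Longrightarrow> cinner (A \<phi> f) k = cinner (mult_op \<phi> f) k"
  by (simp add: tt_apply proj_props)

lemma tt_add: "f \<in> K \<Longrightarrow> g \<in> K \<Longrightarrow> A \<phi> (f + g) = A \<phi> f + A \<phi> g"
  by (simp add: tt_apply model_simps mult_op_add orth_proj_add[OF closed_model csubspace_model])

lemma tt_scaleC: "f \<in> K \<Longrightarrow> A \<phi> (a *\<^sub>C f) = a *\<^sub>C A \<phi> f"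
  by (simp add: tt_apply model_simps mult_op_scaleC orth_proj_scaleC[OF closed_model csubspace_model])

lemma tt_symbol_add: "\<phi> \<in> Linf \<Longrightarrow> \<psi> \<in> Linf \<Longrightarrow> f \<in> K \<Longrightarrow> A (\<lambda>z. \<phi> z + \<psi> z) f = A \<phi> f + A \<psi> f"
  by (simp add: tt_apply mult_op_symbol_add orth_proj_add[OF closed_model csubspace_model])

lemma tt_symbol_scale: "\<phi> \<in> Linf \<Longrightarrow> f \<in> K \<Longrightarrow> A (\<lambda>z. c * \<phi> z) f = c *\<^sub>C A \<phi> f"
  by (simp add: tt_apply mult_op_symbol_scale orth_proj_scaleC[OF closed_model csubspace_model])

lemma tt_symbol_const: "f \<in> K \<Longrightarrow> A (\<lambda>_. c) f = c *\<^sub>C f"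
  by (simp add: tt_apply mult_op_const orth_proj_id[OF csubspace_model] model_simps)

lemma tt_bounded: "\<phi> \<in> Linf \<Longrightarrow> A \<phi> \<in> bounded_ops K"
proof -
  assume \<phi>: "\<phi> \<in> Linf"
  then obtain C where C: "AE z in circle. norm (\<phi> z) \<le> C" by (auto simp: Linf_def)
  have "norm (A \<phi> f) \<le> \<bar>C\<bar> * norm f" if "f \<in> K" for f
    using norm_orth_proj_le[OF closed_model csubspace_model, of "mult_op \<phi> f"]
      norm_mult_op_le[OF \<phi> C, of f] that by (simp add: tt_apply)
  moreover have "A \<phi> \<in> K \<rightarrow>\<^sub>E K"
    by (auto simp: tt_in) (simp add: truncated_toeplitz_def)
  ultimately show ?thesis by (auto simp: bounded_ops_def tt_add tt_scaleC)
qed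

lemma cinner_tt_adjoint:
  "\<phi> \<in> Linf \<Longrightarrow> f \<in> K \<Longrightarrow> g \<in> K \<Longrightarrow> cinner (A \<phi> f) g = cinner f (A (\<lambda>z. cnj (\<phi> z)) g)"
  by (simp add: tt_apply proj_props cinner_mult_op)

text \<open>Conjugating the symbol supplies an explicit candidate for the adjoint, which uniqueness
  then identifies with it.\<close>

lemma adjoint_tt: "\<phi> \<in> Linf \<Longrightarrow> adjoint_op K (A \<phi>) = A (\<lambda>z. cnj (\<phi> z))"
  by (intro adjoint_op_eqI csubspace_model tt_bounded Linf_cnj cinner_tt_adjoint)

text \<open>For bounded F and G in K, F u h1 stays in u H^2 and is orthogonal to G, while <F cnj (u
  h2), G> is the conjugate of <u G h2, F>, which vanishes for the same reason. Totality is then used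
  twice, once for each argument of the form: the first use shows that the conjugate symbol
  annihilates every bounded G, and the second passes to arbitrary \<open>f\<close>.\<close>

lemma tt_eq_0:
  assumes \<phi>: "\<phi> \<in> Linf" and h: "h1 \<in> hardy_space" "h2 \<in> hardy_space"
    and eq: "L2_class \<phi> = mult_op u h1 + L2_cnj (mult_op u h2)" and f: "f \<in> K"
  shows "A \<phi> f = 0"
proof -
  have test: "cinner (mult_op \<phi> (L2_class F)) (L2_class G) = 0"
    if F: "F \<in> Linf" "L2_class F \<in> K" and G: "G \<in> Linf" "L2_class G \<in> K" for F G
  proof -
    have "mult_op \<phi> (L2_class F) = mult_op F (L2_class \<phi>)"
      using \<phi> F by (simp add: mult_op_L2_class mult.commute)
    then have *: "mult_op \<phi> (L2_class F) = mult_op F (mult_op u h1) + mult_op F (L2_cnj (mult_op u h2))"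
      by (simp add: eq mult_op_add)
    have "cinner (mult_op F (mult_op u h1)) (L2_class G) = 0"
      unfolding mult_op_commute[OF F(1) u_Linf]
      by (intro model_orth' G mult_op_hardy F model_hardy h)
    moreover have "cinner (mult_op F (L2_cnj (mult_op u h2))) (L2_class G) = 0"
    proof -
      have "cinner (mult_op F (L2_cnj (mult_op u h2))) (L2_class G)
          = cinner (mult_op (\<lambda>z. cnj (G z)) (L2_cnj (mult_op u h2))) (mult_op (\<lambda>z. cnj (F z)) (powi_class 0))"
        using F G by (simp add: cinner_mult_op cinner_mult_op' L2_class_eq_mult_powi mult_op_commute Linf_cnj)
      also have "\<dots> = cinner (L2_cnj (mult_op G (mult_op u h2))) (L2_cnj (L2_class F))"
        using F G by (simp add: L2_cnj_mult_op L2_cnj_powi_class L2_class_eq_mult_powi)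
      also have "\<dots> = cnj (cinner (mult_op u (mult_op G h2)) (L2_class F))"
        by (simp add: cinner_L2_cnj mult_op_commute[OF G(1) u_Linf])
      also have "\<dots> = 0" by (simp add: model_orth' F mult_op_hardy G model_hardy h)
      finally show ?thesis .
    qed
    ultimately show ?thesis by (simp add: * cinner_add_left)
  qed
  have bounded: "orth_proj K (mult_op (\<lambda>z. cnj (\<phi> z)) (L2_class G)) = 0" if G: "G \<in> Linf" "L2_class G \<in> K" for G
  proof (rule bounded_total)
    fix F assume F: "F \<in> Linf" "L2_class F \<in> K"
    have "cinner (L2_class F) (mult_op (\<lambda>z. cnj (\<phi> z)) (L2_class G)) = 0"
      using test[OF F G] \<phi> by (simp add: cinner_mult_op)
    then show "cinner (orth_proj K (mult_op (\<lambda>z. cnj (\<phi> z)) (L2_class G))) (L2_class F) = 0"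
      using F by (subst cinner_commute) (simp add: proj_props)
  qed (simp add: proj_props)
  show ?thesis
  proof (rule bounded_total[OF tt_in[OF f]])
    fix G assume G: "G \<in> Linf" "L2_class G \<in> K"
    have "cinner (A \<phi> f) (L2_class G) = cinner f (A (\<lambda>z. cnj (\<phi> z)) (L2_class G))"
      by (rule cinner_tt_adjoint[OF \<phi> f G(2)])
    also have "\<dots> = 0" by (simp add: tt_apply G bounded)
    finally show "cinner (A \<phi> f) (L2_class G) = 0" .
  qed
qed

text \<open>In closed form this is (u - u(0)) / z, the backward shift of u. Its pairing with
  \<open>f\<close> measures how far z f is from lying in K.\<close>

definition defect_vec :: l2_circle
  where "defect_vec = orth_proj K (mult_op u (powi_class (- 1)))"

lemma defect_vec_in: "defect_vec \<in> K"
  by (simp add: defect_vec_def proj_props)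

lemma cinner_defect_vec: "f \<in> K \<Longrightarrow> cinner f defect_vec = cinner (mult_op (\<lambda>z. z) f) (mult_op u (powi_class 0))"
proof -
  assume "f \<in> K"
  then have "cinner f defect_vec = cinner f (mult_op u (powi_class (- 1)))"
    by (simp add: defect_vec_def proj_props)
  also have "mult_op u (powi_class (- 1)) = mult_op (\<lambda>z. z powi (- 1)) (mult_op u (powi_class 0))"
    by (simp only: mult_op_commute[OF powi_Linf u_Linf] mult_powi_class) simp
  also have "cinner f \<dots> = cinner (mult_op (\<lambda>z. z powi 1) f) (mult_op u (powi_class 0))"
    by (simp only: cinner_mult_powi)
  finally show ?thesis by simp
qed

text \<open>The space u H^2 is spanned by u and z u H^2, and z f is already orthogonal to the
  latter. Removing its component along the unit vector u therefore lands in K, and the removed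
  multiple of u is orthogonal to K.\<close>

lemma shift_eq: assumes f: "f \<in> K"
  shows "S f = mult_op (\<lambda>z. z) f - cinner f defect_vec *\<^sub>C mult_op u (powi_class 0)"
  unfolding tt_apply[OF f]
proof (rule orth_proj_eqI[OF csubspace_model])
  let ?U = "mult_op u (powi_class 0)"
  have zH: "mult_op (\<lambda>z. z) g \<in> hardy_space" if "g \<in> hardy_space" for g
    using mult_powi_hardy[of 1 g] that by simp
  have UH: "?U \<in> hardy_space" by (intro mult_u_hardy powi_class_hardy) simp
  show "mult_op (\<lambda>z. z) f - cinner f defect_vec *\<^sub>C ?U \<in> K"
  proof (rule model_memI)
    show "mult_op (\<lambda>z. z) f - cinner f defect_vec *\<^sub>C ?U \<in> hardy_space"
      by (intro csubspace_diff csubspace_scaleC csubspace_hardy zH UH model_hardy f)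
    fix h assume h: "h \<in> hardy_space"
    define a where "a = fourier_coeff h 0"
    \<comment> \<open>Splitting off the constant term of \<open>h\<close> and dividing by z gives u
      h = a u + z u h'.\<close>
    define h' where "h' = mult_op (\<lambda>z. z powi (- 1)) (h - a *\<^sub>C powi_class 0)"
    have "h' \<in> hardy_space"
    proof (rule hardy_memI)
      fix m :: int assume "m < 0"
      then have "m + 1 = 0 \<or> m + 1 < 0" by auto
      moreover have "fourier_coeff h' m = fourier_coeff h (m + 1) - a * (if m + 1 = 0 then 1 else 0)"
        unfolding h'_def fourier_coeff_mult_powi by (simp add: fourier_coeff_eq cinner_simps cinner_powi_class)
      ultimately show "fourier_coeff h' m = 0"
        using h by (auto simp: a_def hardy_space_def)
    qed
    have "mult_op (\<lambda>z. z powi 1) h' = h - a *\<^sub>C powi_class 0"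
      unfolding h'_def mult_op_powi_mult by (simp add: mult_op_const)
    then have h_eq: "h = a *\<^sub>C powi_class 0 + mult_op (\<lambda>z. z) h'" by simp
    have "mult_op u h = a *\<^sub>C ?U + mult_op (\<lambda>z. z) (mult_op u h')"
      by (subst h_eq) (simp add: mult_op_add mult_op_scaleC mult_op_commute[OF u_Linf coordinate_Linf])
    moreover have "cinner (mult_op (\<lambda>z. z) f) (mult_op (\<lambda>z. z) (mult_op u h')) = 0"
    proof -
      have "cinner (mult_op (\<lambda>z. z powi 1) f) (mult_op (\<lambda>z. z powi 1) (mult_op u h')) = cinner f (mult_op u h')"
        unfolding cinner_mult_powi mult_op_powi_mult by (simp add: mult_op_const)
      then show ?thesis using model_orth[OF f \<open>h' \<in> hardy_space\<close>] by simp
    qed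
    moreover have "cinner ?U (mult_op u h) = cnj a"
      unfolding cinner_mult_u a_def fourier_coeff_eq by (rule cinner_commute)
    ultimately show "cinner (mult_op (\<lambda>z. z) f - cinner f defect_vec *\<^sub>C ?U) (mult_op u h) = 0"
      by (simp add: cinner_diff_left cinner_scaleC_left) (simp add: cinner_simps cinner_defect_vec f)
  qed
  show "cinner (mult_op (\<lambda>z. z) f - (mult_op (\<lambda>z. z) f - cinner f defect_vec *\<^sub>C ?U)) k = 0" if "k \<in> K" for k
    using model_orth'[OF that powi_class_hardy[of 0]] by (simp add: cinner_simps)
qed

lemma cinner_mult_z: "cinner (mult_op (\<lambda>z. z) f) (mult_op (\<lambda>z. z) g) = cinner f g"
proof -
  have "cinner (mult_op (\<lambda>z. z powi 1) f) (mult_op (\<lambda>z. z powi 1) g) = cinner f g"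
    unfolding cinner_mult_powi mult_op_powi_mult by (simp add: mult_op_const)
  then show ?thesis by simp
qed

text \<open>The u-term of \<open>S f\<close> drops out against \<open>S g\<close>, which lies in K,
  and the u-term of \<open>S g\<close> contributes the rank-one correction.\<close>

lemma cinner_shift:
  assumes f: "f \<in> K" and g: "g \<in> K"
  shows "cinner (S f) (S g) = cinner f g - cinner f defect_vec * cinner defect_vec g"
proof -
  have "cinner (S f) (S g) = cinner (mult_op (\<lambda>z. z) f) (S g)"
    using model_orth'[OF tt_in[OF g] powi_class_hardy[of 0]]
    by (subst shift_eq[OF f]) (simp add: cinner_simps)
  also have "\<dots> = cinner f g - cnj (cinner g defect_vec) * cinner f defect_vec"
    by (simp add: shift_eq[OF g] cinner_simps cinner_mult_z cinner_defect_vec[OF f])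
  also have "cnj (cinner g defect_vec) = cinner defect_vec g" by (rule cinner_commute[symmetric])
  finally show ?thesis by (simp add: mult.commute)
qed

lemma shift_contraction: "contraction_op K S"
proof -
  have "norm (S f) \<le> norm f" if f: "f \<in> K" for f
  proof -
    have "cinner (S f) (S f) = cinner f f - cinner f defect_vec * cnj (cinner f defect_vec)"
      using cinner_shift[OF f f] cinner_commute[of defect_vec f] by simp
    then have "complex_of_real ((norm (S f))\<^sup>2) = complex_of_real ((norm f)\<^sup>2 - (cmod (cinner f defect_vec))\<^sup>2)"
      by (simp add: cinner_self flip: complex_norm_square)
    then have "(norm (S f))\<^sup>2 = (norm f)\<^sup>2 - (cmod (cinner f defect_vec))\<^sup>2" by (simp only: of_real_eq_iff)
    then have "(norm (S f))\<^sup>2 \<le> (norm f)\<^sup>2" by simp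
    then show ?thesis by (rule power2_le_imp_le) simp
  qed
  then show ?thesis by (simp add: contraction_op_def tt_bounded coordinate_Linf)
qed

lemma shift_defect: "f \<in> K \<Longrightarrow> f - adjoint_op K S (S f) = cinner f defect_vec *\<^sub>C defect_vec"
proof -
  assume f: "f \<in> K"
  have "adjoint_op K S (S f) = f - cinner f defect_vec *\<^sub>C defect_vec"
  proof (rule eq_if_cinner_eq[OF csubspace_model])
    show "adjoint_op K S (S f) \<in> K" by (simp add: adjoint_tt coordinate_Linf tt_in f)
    show "f - cinner f defect_vec *\<^sub>C defect_vec \<in> K" by (simp add: model_simps f defect_vec_in)
    fix k assume k: "k \<in> K"
    have "cinner (A cnj (S f)) k = cnj (cinner k (A cnj (S f)))" by (rule cinner_commute)
    also have "\<dots> = cnj (cinner (S k) (S f))"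
      using cinner_tt_adjoint[OF coordinate_Linf k tt_in[OF f]] by simp
    also have "\<dots> = cinner (S f) (S k)" by (rule cinner_commute[symmetric])
    finally show "cinner (adjoint_op K S (S f)) k = cinner (f - cinner f defect_vec *\<^sub>C defect_vec) k"
      by (simp add: adjoint_tt coordinate_Linf cinner_shift f k cinner_simps)
  qed
  then show ?thesis by simp
qed

text \<open>If the vector vanished, S would be plain multiplication by z and K would be invariant
  under it. Pairing z^m f with cnj z u then shows f orthogonal to u z^n for all negative n, so f = 0
  by totality.\<close>

lemma defect_vec_nonzero: assumes "K \<noteq> {0}" shows "defect_vec \<noteq> 0"
proof
  assume "defect_vec = 0"
  then have Sz: "mult_op (\<lambda>z. z) f \<in> K" if "f \<in> K" for f
    using shift_eq[OF that] tt_in[OF that, of "\<lambda>z. z"] by simp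
  have zn: "mult_op (\<lambda>z. z powi int n) f \<in> K" if "f \<in> K" for n f
    using that
  proof (induction n)
    case (Suc n)
    have "mult_op (\<lambda>z. z powi 1) (mult_op (\<lambda>z. z powi int n) f) \<in> K"
      using Sz[OF Suc.IH[OF Suc.prems]] by simp
    then show ?case unfolding mult_op_powi_mult by (simp add: add.commute)
  qed (simp add: mult_op_const)
  have "f = 0" if f: "f \<in> K" for f
  proof (rule model_total[OF f])
    fix n :: int assume "n < 0"
    \<comment> \<open>The shift by one leaves a factor z^(-1) next to u, which is the function whose
      projection is \<open>defect_vec\<close>.\<close>
    define m where "m = nat (- n - 1)"
    then have n: "n = - int m - 1" using \<open>n < 0\<close> by simp
    have "mult_op u (powi_class n) = mult_op (\<lambda>z. z powi (- int m)) (mult_op u (powi_class (- 1)))"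
      by (simp only: mult_op_commute[OF powi_Linf u_Linf] mult_powi_class) (simp add: n)
    then have "cinner f (mult_op u (powi_class n)) = cinner (mult_op (\<lambda>z. z powi int m) f) (mult_op u (powi_class (- 1)))"
      by (simp only: cinner_mult_powi)
    also have "\<dots> = cinner (mult_op (\<lambda>z. z powi int m) f) defect_vec"
      using zn[OF f] by (simp add: defect_vec_def proj_props)
    finally show "cinner f (mult_op u (powi_class n)) = 0" using \<open>defect_vec = 0\<close> by simp
  qed
  then show False using assms model_simps(1) by blast
qed

section \<open>The Agler-Young condition\<close>

text \<open>The conjugation u cnj (z g) exchanges the two defining conditions of K: its membership
  in H^2 is the orthogonality of g to u H^2, and its orthogonality to u H^2 is the membership of g
  in H^2.\<close>

lemma conj_reflection_model:
  assumes g: "g \<in> K"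
  shows "mult_op (\<lambda>z. z powi (- 1)) (mult_op u (L2_cnj g)) \<in> K"
proof (rule model_memI)
  let ?J = "mult_op (\<lambda>z. z powi (- 1)) (mult_op u (L2_cnj g))"
  have cnj: "cinner (L2_cnj g) (mult_op (\<lambda>z. cnj (\<phi> z)) (L2_cnj h)) = cnj (cinner g (mult_op \<phi> h))"
    if "\<phi> \<in> Linf" for \<phi> h
    by (simp add: that L2_cnj_mult_op[symmetric] cinner_L2_cnj)
  show "?J \<in> hardy_space"
  proof (rule hardy_memI)
    fix n :: int assume n: "n < 0"
    have "fourier_coeff ?J n = cinner (mult_op u (L2_cnj g)) (powi_class (n + 1))"
      by (simp only: fourier_coeff_mult_powi) (simp add: fourier_coeff_eq)
    also have "\<dots> = cinner (L2_cnj g) (mult_op (\<lambda>z. cnj (u z)) (powi_class (n + 1)))"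
      by (simp add: cinner_mult_op u_Linf)
    also have "\<dots> = cnj (cinner g (mult_op u (powi_class (- n - 1))))"
      using cnj[OF u_Linf, of "powi_class (- n - 1)"] by (simp add: L2_cnj_powi_class add.commute)
    also have "\<dots> = 0" using n by (simp add: model_orth[OF g] powi_class_hardy)
    finally show "fourier_coeff ?J n = 0" .
  qed
  fix h assume h: "h \<in> hardy_space"
  have "cinner ?J (mult_op u h) = cinner (mult_op (\<lambda>z. z powi (- 1)) (L2_cnj g)) h"
    by (simp only: mult_op_commute[OF powi_Linf u_Linf] cinner_mult_u)
  also have "\<dots> = 0"
  proof (rule cinner_anti_hardy[OF _ h])
    fix n :: int assume "0 \<le> n"
    then show "fourier_coeff (mult_op (\<lambda>z. z powi (- 1)) (L2_cnj g)) n = 0"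
      using model_hardy[OF g] by (simp only: fourier_coeff_mult_powi fourier_coeff_L2_cnj) (simp add: hardy_space_def)
  qed
  finally show "cinner ?J (mult_op u h) = 0" .
qed

text \<open>The hypothesis is applied to the conjugate u cnj (z g) of \<open>g\<close>. Multiplying
  that by z gives u cnj g, and the unimodular u cancels, leaving <\<psi>, cnj g> = 0.\<close>

lemma conj_symbol_orth_model:
  assumes \<psi>: "\<psi> \<in> Linf"
    and orth: "\<And>g. g \<in> K \<Longrightarrow> cinner (mult_op \<psi> (mult_op u (powi_class 0))) (mult_op (\<lambda>z. z) g) = 0"
    and g: "g \<in> K"
  shows "cinner (L2_cnj (L2_class \<psi>)) g = 0"
proof -
  let ?J = "mult_op (\<lambda>z. z powi (- 1)) (mult_op u (L2_cnj g))"
  have "mult_op (\<lambda>z. z powi 1) ?J = mult_op u (L2_cnj g)"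
    unfolding mult_op_powi_mult by (simp add: mult_op_const)
  then have "cinner (mult_op \<psi> (mult_op u (powi_class 0))) (mult_op u (L2_cnj g)) = 0"
    using orth[OF conj_reflection_model[OF g]] by simp
  then have "cinner (L2_class \<psi>) (L2_cnj g) = 0"
    by (simp only: mult_op_commute[OF \<psi> u_Linf] cinner_mult_u L2_class_eq_mult_powi[OF \<psi>])
  then show ?thesis using cinner_L2_cnj[of "L2_class \<psi>" "L2_cnj g"] by simp
qed

text \<open>A general \<open>f\<close> has a part outside H^2, about which orthogonality to K says
  nothing. Its Hardy projection is still orthogonal to K, hence lies in u H^2, and it has the same
  coefficients of nonnegative index.\<close>

lemma orth_model_decomp:
  assumes "\<And>k. k \<in> K \<Longrightarrow> cinner f k = 0"
  shows "\<exists>h\<in>hardy_space. \<forall>n\<ge>0. fourier_coeff f n = fourier_coeff (mult_op u h) n"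
proof -
  note H = closed_hardy csubspace_hardy
  have "\<exists>h\<in>hardy_space. orth_proj hardy_space f = mult_op u h"
    by (rule orth_model_imp_mult_u) (simp_all add: orth_proj_props[OF H] model_hardy assms)
  then obtain h where h: "h \<in> hardy_space" "orth_proj hardy_space f = mult_op u h" by blast
  have "fourier_coeff f n = fourier_coeff (mult_op u h) n" if "n \<ge> 0" for n
    using orth_proj_props(2)[OF H powi_class_hardy[OF that], of f] by (simp add: fourier_coeff_eq h)
  then show ?thesis using h by blast
qed

text \<open>The two hypotheses control the positive and, through conjugation, the negative
  coefficients of \<phi>. The constants \<open>a\<close> and \<open>b\<close> disturb index 0 only,
  so the total discrepancy is a constant.\<close>

lemma symbol_decomp:
  assumes \<phi>: "\<phi> \<in> Linf"
    and a: "\<And>k. k \<in> K \<Longrightarrow> cinner (L2_cnj (L2_class \<phi>) - a *\<^sub>C powi_class 0) k = 0"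
    and b: "\<And>k. k \<in> K \<Longrightarrow> cinner (L2_class \<phi> - b *\<^sub>C powi_class 0) k = 0"
  shows "\<exists>d. \<exists>h1\<in>hardy_space. \<exists>h2\<in>hardy_space.
    L2_class \<phi> = d *\<^sub>C powi_class 0 + (mult_op u h1 + L2_cnj (mult_op u h2))"
proof -
  obtain h1 where h1: "h1 \<in> hardy_space"
    "\<And>n. n \<ge> 0 \<Longrightarrow> fourier_coeff (L2_class \<phi> - b *\<^sub>C powi_class 0) n = fourier_coeff (mult_op u h1) n"
    using orth_model_decomp[OF b] by blast
  obtain h2 where h2: "h2 \<in> hardy_space"
    "\<And>n. n \<ge> 0 \<Longrightarrow> fourier_coeff (L2_cnj (L2_class \<phi>) - a *\<^sub>C powi_class 0) n = fourier_coeff (mult_op u h2) n"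
    using orth_model_decomp[OF a] by blast
  \<comment> \<open>u h1 has no negative coefficients and the conjugate of u h2 no positive ones, so
    the two corrections do not interfere away from index 0.\<close>
  define r where "r = L2_class \<phi> - (mult_op u h1 + L2_cnj (mult_op u h2))"
  define d where "d = fourier_coeff r 0"
  have neg: "fourier_coeff (mult_op u h) n = 0" if "h \<in> hardy_space" "n < 0" for h n
    using mult_u_hardy[OF that(1)] that(2) by (simp add: hardy_space_def)
  have r: "fourier_coeff r n = fourier_coeff (L2_class \<phi>) n - fourier_coeff (mult_op u h1) n
      - cnj (fourier_coeff (mult_op u h2) (- n))" for n
    using fourier_coeff_L2_cnj[of "mult_op u h2" n] by (simp add: r_def fourier_coeff_eq cinner_simps)
  have "r - d *\<^sub>C powi_class 0 = 0"
  proof (rule fourier_coeff_unique)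
    fix n :: int
    have e: "fourier_coeff (r - d *\<^sub>C powi_class 0) n = fourier_coeff r n - d * (if n = 0 then 1 else 0)"
      by (simp add: fourier_coeff_eq cinner_simps cinner_powi_class)
    consider "n = 0" | "n > 0" | "n < 0" by linarith
    then show "fourier_coeff (r - d *\<^sub>C powi_class 0) n = 0"
    proof cases
      case 1
      then show ?thesis unfolding e by (simp add: d_def)
    next
      case 2
      then have "fourier_coeff (L2_class \<phi>) n = fourier_coeff (mult_op u h1) n"
        using h1(2)[of n] by (simp add: fourier_coeff_eq cinner_simps cinner_powi_class)
      then show ?thesis using 2 by (simp add: e r neg h2)
    next
      case 3
      then have "fourier_coeff (mult_op u h2) (- n) = fourier_coeff (L2_cnj (L2_class \<phi>)) (- n)"
        using h2(2)[of "- n"] by (simp add: fourier_coeff_eq cinner_simps cinner_powi_class)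
      then show ?thesis using 3 by (simp add: e r neg h1 fourier_coeff_L2_cnj)
    qed
  qed
  then have "L2_class \<phi> = d *\<^sub>C powi_class 0 + (mult_op u h1 + L2_cnj (mult_op u h2))"
    by (simp add: r_def algebra_simps)
  then show ?thesis using h1 h2 by blast
qed

lemma tt_intertwining_symbol:
  assumes K: "K \<noteq> {0}" and \<phi>: "\<phi> \<in> Linf"
    and eq: "\<And>f. f \<in> K \<Longrightarrow> A \<phi> f = A (\<lambda>z. cnj (\<phi> z)) (S f)"
  shows "\<exists>h1\<in>hardy_space. \<exists>h2\<in>hardy_space. L2_class \<phi> = mult_op u h1 + L2_cnj (mult_op u h2)"
proof -
  let ?k = defect_vec and ?U = "mult_op u (powi_class 0)" and ?z = "mult_op (\<lambda>z. z)"
  let ?\<phi>' = "\<lambda>z. cnj (\<phi> z)"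
  have kk: "cinner ?k ?k \<noteq> 0" using defect_vec_nonzero[OF K] by simp
  have adj: "cinner (A ?\<phi>' f) g = cinner f (A \<phi> g)" if "f \<in> K" "g \<in> K" for f g
    using cinner_tt_adjoint[OF Linf_cnj[OF \<phi>] that] by simp
  have comm: "cinner (mult_op \<phi> (?z f)) (?z g) = cinner (mult_op \<phi> f) g" for f g
    by (simp add: mult_op_commute[OF \<phi> coordinate_Linf] cinner_mult_z)
  \<comment> \<open>The expansion of A = S* A S as a form: the terms <\<phi> z f, z g> and <\<phi>
    f, g> cancel, and every remaining term carries a pairing with the defect vector.\<close>
  have main: "cinner f ?k * cinner (mult_op \<phi> ?U) (?z g) + cnj (cinner g ?k) * cinner (mult_op \<phi> (?z f)) ?U
      = cinner f ?k * cnj (cinner g ?k) * cinner (mult_op \<phi> ?U) ?U" if f: "f \<in> K" and g: "g \<in> K" for f g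
  proof -
    have "cinner (A \<phi> f) g = cinner (S f) (A \<phi> g)" by (simp add: eq f adj tt_in g)
    also have "\<dots> = cinner (A \<phi> (S f)) (S g)" by (simp only: eq[OF g] cinner_tt_adjoint[OF \<phi> tt_in[OF f] tt_in[OF g]])
    finally have "cinner (mult_op \<phi> f) g = cinner (mult_op \<phi> (S f)) (S g)"
      by (simp add: cinner_tt f g tt_in)
    also have "\<dots> = cinner (mult_op \<phi> (?z f - cinner f ?k *\<^sub>C ?U)) (?z g - cinner g ?k *\<^sub>C ?U)"
      by (simp only: shift_eq f g)
    finally show ?thesis
      by (simp add: mult_op_diff mult_op_scaleC cinner_simps comm algebra_simps)
  qed
  \<comment> \<open>With one argument set to the defect vector, \<open>x\<close> is its squared norm
    or the conjugate of that, hence nonzero, and the remaining unknown \<open>p\<close> is a fixed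
    multiple of \<open>c\<close>.\<close>
  have solve: "p = (x * r - q) / x * c" if "x * p + c * q = x * c * r" "x \<noteq> 0" for p q r c x :: complex
  proof -
    from that(1) have "p * x = (x * r - q) * c" by (simp add: algebra_simps)
    then show ?thesis using that(2) by (simp add: field_simps)
  qed
  define a where "a = (cinner ?k ?k * cinner (mult_op \<phi> ?U) ?U - cinner (mult_op \<phi> (?z ?k)) ?U) / cinner ?k ?k"
  define b where "b = (cnj (cinner ?k ?k) * cinner (mult_op \<phi> ?U) ?U - cinner (mult_op \<phi> ?U) (?z ?k)) / cnj (cinner ?k ?k)"
  have a: "cinner (mult_op (\<lambda>z. \<phi> z - a) ?U) (?z g) = 0" if g: "g \<in> K" for g
  proof -
    have "cinner (mult_op \<phi> ?U) (?z g) = a * cnj (cinner g ?k)"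
      unfolding a_def by (rule solve[OF main[OF defect_vec_in g] kk])
    \<comment> \<open>Rewriting <g, k> as <z g, u> lets the multiple \<open>a\<close> be absorbed
      into the symbol.\<close>
    then have "cinner (mult_op \<phi> ?U) (?z g) = a * cnj (cinner (?z g) ?U)"
      by (simp only: cinner_defect_vec[OF g])
    then show ?thesis
      by (simp add: mult_op_symbol_diff \<phi> const_Linf mult_op_const cinner_simps cinner_commute[of ?U])
  qed
  \<comment> \<open>The symbol is conjugated so that the conjugation in
    \<open>conj_symbol_orth_model\<close> returns \<phi> - b itself.\<close>
  have b: "cinner (mult_op (\<lambda>z. cnj (\<phi> z) - cnj b) ?U) (?z f) = 0" if f: "f \<in> K" for f
  proof -
    have "cinner (mult_op \<phi> (?z f)) ?U = b * cinner f ?k"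
      unfolding b_def by (rule solve) (use main[OF f defect_vec_in] kk in \<open>simp_all add: algebra_simps\<close>)
    then have "cinner (mult_op \<phi> (?z f)) ?U = b * cinner (?z f) ?U"
      by (simp only: cinner_defect_vec[OF f])
    then have "cinner (?z f) (mult_op (\<lambda>z. cnj (\<phi> z) - cnj b) ?U) = 0"
      by (simp add: mult_op_symbol_diff \<phi> Linf_cnj const_Linf mult_op_const cinner_simps cinner_mult_op)
    then show ?thesis by (subst cinner_commute) simp
  qed
  have cls: "L2_class (\<lambda>z. \<psi> z - c) = L2_class \<psi> - c *\<^sub>C powi_class 0" if "\<psi> \<in> Linf" for \<psi> c
    by (simp add: L2_class_diff that const_Linf L2_class_const[of c] L2_class_one)
  have "cinner (L2_cnj (L2_class \<phi>) - cnj a *\<^sub>C powi_class 0) k = 0" if "k \<in> K" for k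
    using conj_symbol_orth_model[OF Linf_diff[OF \<phi> const_Linf] a that]
    by (simp add: cls \<phi> L2_cnj_diff L2_cnj_scaleC L2_cnj_powi_class)
  moreover have "cinner (L2_class \<phi> - b *\<^sub>C powi_class 0) k = 0" if "k \<in> K" for k
    using conj_symbol_orth_model[OF Linf_diff[OF Linf_cnj[OF \<phi>] const_Linf] b that]
    by (simp add: cls \<phi> Linf_cnj L2_cnj_diff L2_cnj_scaleC L2_cnj_powi_class L2_cnj_L2_class[symmetric])
  ultimately obtain d h1 h2 where h: "h1 \<in> hardy_space" "h2 \<in> hardy_space"
    and dec: "L2_class \<phi> = d *\<^sub>C powi_class 0 + (mult_op u h1 + L2_cnj (mult_op u h2))"
    using symbol_decomp[OF \<phi>] by blast
  have A: "A \<phi> f = d *\<^sub>C f" if f: "f \<in> K" for f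
  proof -
    have "A (\<lambda>z. \<phi> z - d) f = 0"
      by (rule tt_eq_0[OF Linf_diff[OF \<phi> const_Linf] h _ f]) (simp add: cls \<phi> dec)
    then show ?thesis
      using tt_symbol_add[OF Linf_diff[OF \<phi> const_Linf] const_Linf f, of d d] by (simp add: tt_symbol_const f)
  qed
  have "d *\<^sub>C ?k = cnj d *\<^sub>C S ?k"
  proof (rule eq_if_cinner_eq[OF csubspace_model])
    fix g assume g: "g \<in> K"
    have "cinner (A \<phi> ?k) g = cinner (S ?k) (A \<phi> g)" by (simp add: eq defect_vec_in adj tt_in g)
    then show "cinner (d *\<^sub>C ?k) g = cinner (cnj d *\<^sub>C S ?k) g"
      by (simp add: A defect_vec_in g cinner_simps)
  qed (simp_all add: model_simps defect_vec_in tt_in)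
  then have "cinner (d *\<^sub>C ?k) (d *\<^sub>C ?k) = cinner (cnj d *\<^sub>C S ?k) (cnj d *\<^sub>C S ?k)" by simp
  \<comment> \<open>By \<open>cinner_shift\<close> the squared norm of \<open>S ?k\<close> is that
    of \<open>?k\<close> minus its own square, so comparing both sides leaves |d|^2 |k|^4 =
    0.\<close>
  then have "d * cnj d * (cinner ?k ?k * cinner ?k ?k) = 0"
    by (simp add: cinner_simps cinner_shift defect_vec_in algebra_simps)
  then have "d = 0" using kk by simp
  then show ?thesis using h dec by auto
qed

section \<open>The defect operator of the shift and the Agler-Young condition as a scalar
  identity\<close>

lemma defect_op_shift:
  assumes "K \<noteq> {0}"
  shows "defect_op K S = (\<lambda>x\<in>K. (cinner x defect_vec / complex_of_real (norm defect_vec)) *\<^sub>C defect_vec)"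
  unfolding defect_op_def
  by (rule sqrt_op_rank_one[OF csubspace_model defect_vec_in defect_vec_nonzero[OF assms]])
    (simp add: shift_defect)

lemma defect_space_shift:
  assumes "K \<noteq> {0}"
  shows "defect_space K S = range (\<lambda>a. a *\<^sub>C defect_vec)"
proof -
  let ?k = defect_vec
  have "defect_op K S ` K = range (\<lambda>a. a *\<^sub>C ?k)"
  proof (intro equalityI subsetI)
    fix x assume "x \<in> range (\<lambda>a. a *\<^sub>C ?k)"
    then obtain a where x: "x = a *\<^sub>C ?k" by blast
    \<comment> \<open>The defect operator multiplies its own direction by \<open>norm ?k\<close>,
      which the preimage divides out.\<close>
    have "defect_op K S ((a / complex_of_real (norm ?k)) *\<^sub>C ?k) = x"
      using defect_vec_nonzero[OF assms]
      by (simp add: defect_op_shift assms model_simps defect_vec_in cinner_simps cinner_self x power2_eq_square)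
    then show "x \<in> defect_op K S ` K" by (metis imageI model_simps(4) defect_vec_in)
  qed (auto simp: defect_op_shift assms)
  then show ?thesis
    unfolding defect_space_def by (simp add: range_scaleC_eq closed_orth_compl closure_closed)
qed

text \<open>On the defect line every operator is multiplication by a scalar. Each of the two defect
  operators carries a factor 1 / |k|, and together these cancel the <k, k> that arises in composing,
  so D X D is the scalar of X times the rank-one form.\<close>

lemma agler_young_shift_iff:
  assumes K: "K \<noteq> {0}" and \<phi>: "\<phi> \<in> Linf"
  shows "agler_young K (A \<phi>) S \<longleftrightarrow>
    (\<exists>l. \<forall>f\<in>K. A \<phi> f - A (\<lambda>z. cnj (\<phi> z)) (S f) = (l * cinner f defect_vec) *\<^sub>C defect_vec)"
proof
  let ?k = defect_vec and ?D = "defect_op K S"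
  have n0: "complex_of_real (norm ?k) \<noteq> 0" using defect_vec_nonzero[OF K] by simp
  have D: "?D x = (cinner x ?k / complex_of_real (norm ?k)) *\<^sub>C ?k" if "x \<in> K" for x
    using that by (simp add: defect_op_shift K)
  have sub: "range (\<lambda>a. a *\<^sub>C ?k) \<subseteq> K" using model_simps(4)[OF defect_vec_in] by blast
  {
    assume "agler_young K (A \<phi>) S"
    then obtain X where X: "X \<in> bounded_ops (range (\<lambda>a. a *\<^sub>C ?k))"
      "\<And>x. x \<in> K \<Longrightarrow> A \<phi> x - A (\<lambda>z. cnj (\<phi> z)) (S x) = ?D (X (?D x))"
      by (auto simp: agler_young_def adjoint_tt \<phi> defect_space_shift K)
    have kr: "?k \<in> range (\<lambda>a. a *\<^sub>C ?k)" by (metis rangeI scaleC_one)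
    then have XK: "X ?k \<in> K" and Xs: "X (a *\<^sub>C ?k) = a *\<^sub>C X ?k" for a
    proof -
      have "X \<in> range (\<lambda>a. a *\<^sub>C ?k) \<rightarrow>\<^sub>E range (\<lambda>a. a *\<^sub>C ?k)"
        and "\<forall>a. \<forall>x\<in>range (\<lambda>a. a *\<^sub>C ?k). X (a *\<^sub>C x) = a *\<^sub>C X x"
        using X(1) unfolding bounded_ops_def by blast+
      then show "X ?k \<in> K" "X (a *\<^sub>C ?k) = a *\<^sub>C X ?k"
        using kr sub PiE_mem by blast+
    qed
    \<comment> \<open>This quotient is the scalar by which \<open>X\<close> acts, expressed in the
      basis \<open>?k\<close>.\<close>
    have "?D (X (?D x)) = (cinner (X ?k) ?k / (complex_of_real (norm ?k))\<^sup>2 * cinner x ?k) *\<^sub>C ?k" if x: "x \<in> K" for x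
      by (simp add: D x Xs XK model_simps cinner_simps scaleC_scaleC power2_eq_square mult.commute)
    then show "\<exists>l. \<forall>f\<in>K. A \<phi> f - A (\<lambda>z. cnj (\<phi> z)) (S f) = (l * cinner f ?k) *\<^sub>C ?k"
      using X(2) by (intro exI[of _ "cinner (X ?k) ?k / (complex_of_real (norm ?k))\<^sup>2"]) simp
  next
    assume "\<exists>l. \<forall>f\<in>K. A \<phi> f - A (\<lambda>z. cnj (\<phi> z)) (S f) = (l * cinner f ?k) *\<^sub>C ?k"
    then obtain l where l: "\<And>f. f \<in> K \<Longrightarrow> A \<phi> f - A (\<lambda>z. cnj (\<phi> z)) (S f) = (l * cinner f ?k) *\<^sub>C ?k"
      by blast
    define X where "X = (\<lambda>x\<in>range (\<lambda>a. a *\<^sub>C ?k). l *\<^sub>C x)"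
    have cs: "csubspace (range (\<lambda>a. a *\<^sub>C ?k))" by (simp add: range_scaleC_eq csubspace_orth_compl)
    have "X \<in> bounded_ops (range (\<lambda>a. a *\<^sub>C ?k))"
      unfolding X_def by (rule scaleC_bounded_ops[OF cs])
    moreover have "A \<phi> x - A (\<lambda>z. cnj (\<phi> z)) (S x) = ?D (X (?D x))" if x: "x \<in> K" for x
    proof -
      have "?D x \<in> range (\<lambda>a. a *\<^sub>C ?k)" by (simp add: D x)
      then have "X (?D x) = l *\<^sub>C ?D x" by (simp add: X_def)
      then have "?D (X (?D x)) = (l * cinner x ?k) *\<^sub>C ?k"
        using n0 by (simp add: D x model_simps defect_vec_in cinner_simps cinner_self scaleC_scaleC power2_eq_square)
      then show ?thesis by (simp add: l x)
    qed
    ultimately show "agler_young K (A \<phi>) S"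
      by (auto simp: agler_young_def adjoint_tt \<phi> defect_space_shift K tt_bounded shift_contraction)
  }
qed

text \<open>Both the symbol and its conjugate are split, because A - A* S involves the operator and
  its adjoint.\<close>

lemma tt_affine_symbol:
  assumes \<phi>: "\<phi> \<in> Linf" and f: "f \<in> K"
  shows "A \<phi> f = A (\<lambda>z. \<phi> z - (a + b * z)) f + a *\<^sub>C f + b *\<^sub>C S f"
    and "A (\<lambda>z. cnj (\<phi> z)) f = A (\<lambda>z. cnj (\<phi> z - (a + b * z))) f + cnj a *\<^sub>C f + cnj b *\<^sub>C A cnj f"
proof -
  have L: "(\<lambda>z. \<phi> z - (a + b * z)) \<in> Linf" by (intro Linf_intros \<phi>)
  have cL: "cnj \<in> Linf" using Linf_cnj[OF coordinate_Linf] by simp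
  have "A \<phi> f = A (\<lambda>z. (\<phi> z - (a + b * z)) + (a + b * z)) f" by simp
  also have "\<dots> = A (\<lambda>z. \<phi> z - (a + b * z)) f + (A (\<lambda>_. a) f + A (\<lambda>z. b * z) f)"
    using tt_symbol_add[OF L _ f, of "\<lambda>z. a + b * z"] tt_symbol_add[OF const_Linf _ f, of "\<lambda>z. b * z" a]
    by (simp add: Linf_intros)
  finally show "A \<phi> f = A (\<lambda>z. \<phi> z - (a + b * z)) f + a *\<^sub>C f + b *\<^sub>C S f"
    using tt_symbol_scale[OF coordinate_Linf f, of b] by (simp add: tt_symbol_const f)
  have "A (\<lambda>z. cnj (\<phi> z)) f = A (\<lambda>z. cnj (\<phi> z - (a + b * z)) + (cnj a + cnj b * cnj z)) f" by simp
  also have "\<dots> = A (\<lambda>z. cnj (\<phi> z - (a + b * z))) f + (A (\<lambda>_. cnj a) f + A (\<lambda>z. cnj b * cnj z) f)"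
    using tt_symbol_add[OF Linf_cnj[OF L] _ f, of "\<lambda>z. cnj a + cnj b * cnj z"]
      tt_symbol_add[OF const_Linf _ f, of "\<lambda>z. cnj b * cnj z" "cnj a"]
    by (simp add: Linf_intros cL Linf_mult)
  finally show "A (\<lambda>z. cnj (\<phi> z)) f = A (\<lambda>z. cnj (\<phi> z - (a + b * z))) f + cnj a *\<^sub>C f + cnj b *\<^sub>C A cnj f"
    using tt_symbol_scale[OF cL f, of "cnj b"] by (simp add: tt_symbol_const f)
qed

lemma agler_young_imp_symbol:
  assumes K: "K \<noteq> {0}" and \<phi>: "\<phi> \<in> Linf" and AY: "agler_young K (A \<phi>) S"
  shows "\<exists>c. \<exists>g \<in> mult_op u ` hardy_space + L2_cnj ` mult_op u ` hardy_space.
    L2_class \<phi> = L2_class (\<lambda>z. cnj c + c * z) + g"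
proof -
  obtain l where l: "\<And>f. f \<in> K \<Longrightarrow>
      A \<phi> f - A (\<lambda>z. cnj (\<phi> z)) (S f) = (l * cinner f defect_vec) *\<^sub>C defect_vec"
    using AY agler_young_shift_iff[OF K \<phi>] by blast
  \<comment> \<open>The operator B = l I + cnj l S satisfies B - B* S = l (I - S* S), since its two
    terms in S cancel. Removing this part therefore removes the whole rank-one right-hand
    side.\<close>
  define \<psi> where "\<psi> z = \<phi> z - (l + cnj l * z)" for z
  have aff: "(\<lambda>z. l + cnj l * z) \<in> Linf" by (intro Linf_intros)
  have \<psi>: "\<psi> \<in> Linf" unfolding \<psi>_def by (intro Linf_diff \<phi> aff)
  have "A \<psi> f = A (\<lambda>z. cnj (\<psi> z)) (S f)" if f: "f \<in> K" for f
  proof -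
    have 1: "A \<phi> f = A \<psi> f + l *\<^sub>C f + cnj l *\<^sub>C S f"
      using tt_affine_symbol(1)[OF \<phi> f, where a = l and b = "cnj l"] by (simp add: \<psi>_def[abs_def])
    have 2: "A (\<lambda>z. cnj (\<phi> z)) (S f) = A (\<lambda>z. cnj (\<psi> z)) (S f) + cnj l *\<^sub>C S f + l *\<^sub>C A cnj (S f)"
      using tt_affine_symbol(2)[OF \<phi> tt_in[OF f], where a = l and b = "cnj l"] by (simp add: \<psi>_def[abs_def])
    have "l *\<^sub>C (f - A cnj (S f)) = (l * cinner f defect_vec) *\<^sub>C defect_vec"
      using shift_defect[OF f] by (simp add: adjoint_tt coordinate_Linf scaleC_scaleC)
    also have "\<dots> = A \<psi> f - A (\<lambda>z. cnj (\<psi> z)) (S f) + l *\<^sub>C (f - A cnj (S f))"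
      unfolding l[OF f, symmetric] 1 2 by (simp add: scaleC_diff_right)
    finally show ?thesis by simp
  qed
  then obtain h1 h2 where h: "h1 \<in> hardy_space" "h2 \<in> hardy_space"
    "L2_class \<psi> = mult_op u h1 + L2_cnj (mult_op u h2)"
    using tt_intertwining_symbol[OF K \<psi>] by blast
  have "L2_class \<psi> = L2_class \<phi> - L2_class (\<lambda>z. l + cnj l * z)"
    unfolding \<psi>_def by (rule L2_class_diff[OF \<phi> aff])
  \<comment> \<open>The constant in the required form is \<open>c = cnj l\<close>.\<close>
  then have "L2_class \<phi> = L2_class (\<lambda>z. cnj (cnj l) + cnj l * z) + (mult_op u h1 + L2_cnj (mult_op u h2))"
    using h(3) by (simp add: algebra_simps)
  moreover have "mult_op u h1 + L2_cnj (mult_op u h2) \<in> mult_op u ` hardy_space + L2_cnj ` mult_op u ` hardy_space"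
    using h by (intro set_plus_intro imageI)
  ultimately show ?thesis by blast
qed

text \<open>Conjugating the symbol exchanges the roles of h1 and h2, so the residual symbol and its
  conjugate both induce the zero operator.\<close>

lemma tt_of_symbol:
  assumes \<phi>: "\<phi> \<in> Linf" and g: "g \<in> mult_op u ` hardy_space + L2_cnj ` mult_op u ` hardy_space"
    and eq: "L2_class \<phi> = L2_class (\<lambda>z. cnj c + c * z) + g" and f: "f \<in> K"
  shows "A \<phi> f = cnj c *\<^sub>C f + c *\<^sub>C S f" "A (\<lambda>z. cnj (\<phi> z)) f = c *\<^sub>C f + cnj c *\<^sub>C A cnj f"
proof -
  obtain h1 h2 where h: "h1 \<in> hardy_space" "h2 \<in> hardy_space" "g = mult_op u h1 + L2_cnj (mult_op u h2)"
    using g by (auto elim!: set_plus_elim)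
  define \<psi> where "\<psi> z = \<phi> z - (cnj c + c * z)" for z
  have aff: "(\<lambda>z. cnj c + c * z) \<in> Linf" by (intro Linf_intros)
  have \<psi>: "\<psi> \<in> Linf" unfolding \<psi>_def by (intro Linf_diff \<phi> aff)
  have "L2_class \<psi> = L2_class \<phi> - L2_class (\<lambda>z. cnj c + c * z)"
    unfolding \<psi>_def by (rule L2_class_diff[OF \<phi> aff])
  then have cls: "L2_class \<psi> = mult_op u h1 + L2_cnj (mult_op u h2)" by (simp add: eq h)
  have "A \<psi> f = 0" by (rule tt_eq_0[OF \<psi> h(1,2) cls f])
  moreover have "A (\<lambda>z. cnj (\<psi> z)) f = 0"
    by (rule tt_eq_0[OF Linf_cnj[OF \<psi>] h(2,1) _ f])
      (simp add: L2_cnj_L2_class[OF \<psi>, symmetric] cls L2_cnj_add add.commute)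
  ultimately show "A \<phi> f = cnj c *\<^sub>C f + c *\<^sub>C S f" "A (\<lambda>z. cnj (\<phi> z)) f = c *\<^sub>C f + cnj c *\<^sub>C A cnj f"
    using tt_affine_symbol[OF \<phi> f, where a = "cnj c" and b = c] by (simp_all add: \<psi>_def[abs_def])
qed

lemma symbol_imp_agler_young:
  assumes K: "K \<noteq> {0}" and \<phi>: "\<phi> \<in> Linf"
    and g: "g \<in> mult_op u ` hardy_space + L2_cnj ` mult_op u ` hardy_space"
    and eq: "L2_class \<phi> = L2_class (\<lambda>z. cnj c + c * z) + g"
  shows "agler_young K (A \<phi>) S"
proof -
  have "A \<phi> f - A (\<lambda>z. cnj (\<phi> z)) (S f) = (cnj c * cinner f defect_vec) *\<^sub>C defect_vec" if f: "f \<in> K" for f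
  proof -
    \<comment> \<open>The terms \<open>c *\<^sub>C S f\<close> coming from the operator and from its
      adjoint cancel, leaving \<open>cnj c\<close> times I - S* S.\<close>
    have "A \<phi> f - A (\<lambda>z. cnj (\<phi> z)) (S f) = cnj c *\<^sub>C (f - A cnj (S f))"
      by (simp add: tt_of_symbol[OF \<phi> g eq] f tt_in scaleC_diff_right)
    also have "\<dots> = (cnj c * cinner f defect_vec) *\<^sub>C defect_vec"
      using shift_defect[OF f] by (simp add: adjoint_tt coordinate_Linf scaleC_scaleC)
    finally show ?thesis .
  qed
  then show ?thesis using agler_young_shift_iff[OF K \<phi>] by blast
qed

text \<open>On K the operator is a polynomial of degree at most one in S. Since
  \<open>compose K\<close> is extensional, agreement on K gives equality of functions.\<close>

lemma symbol_imp_commute: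
  assumes \<phi>: "\<phi> \<in> Linf"
    and g: "g \<in> mult_op u ` hardy_space + L2_cnj ` mult_op u ` hardy_space"
    and eq: "L2_class \<phi> = L2_class (\<lambda>z. cnj c + c * z) + g"
  shows "compose K (A \<phi>) S = compose K S (A \<phi>)"
proof (rule extensionalityI)
  show "compose K (A \<phi>) S f = compose K S (A \<phi>) f" if "f \<in> K" for f
    using that by (simp add: compose_def tt_of_symbol(1)[OF \<phi> g eq] tt_in tt_add tt_scaleC model_simps)
qed (rule compose_extensional)+

end

theorem theorem4:
  fixes u \<phi> :: "complex \<Rightarrow> complex"
  assumes "inner_function u"
    and "model_space u \<noteq> {0}"
    and "model_space u \<subset> hardy_space"
    and "\<phi> \<in> Linf"
  shows "(agler_young (model_space u) (truncated_toeplitz u \<phi>) (truncated_toeplitz u (\<lambda>z. z)) \<longleftrightarrow>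
      (\<exists>c::complex. \<exists>g \<in> mult_op u ` hardy_space + L2_cnj ` mult_op u ` hardy_space.
         L2_class \<phi> = L2_class (\<lambda>z. cnj c + c * z) + g)) \<and>
    (agler_young (model_space u) (truncated_toeplitz u \<phi>) (truncated_toeplitz u (\<lambda>z. z)) \<longrightarrow>
      compose (model_space u) (truncated_toeplitz u \<phi>) (truncated_toeplitz u (\<lambda>z. z)) =
      compose (model_space u) (truncated_toeplitz u (\<lambda>z. z)) (truncated_toeplitz u \<phi>))"
proof -
  interpret inner_symbol u by unfold_locales (rule assms(1))
  show ?thesis
    using agler_young_imp_symbol[OF assms(2,4)] symbol_imp_agler_young[OF assms(2,4)]
      symbol_imp_commute[OF assms(4)] by blast
qed

end
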